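(* Let $\lambda\in(0,\tfrac12)$, $\epsilon>0$, $\epsilon_1>0$, $\epsilon_2\ge0$, $\rho>0$, and let $m,n$ be positive integers with $N=mn$. Suppose that in every replication the algorithm's output satisfies the Outer Approximation Condition and the Termination Condition with tolerance $\epsilon_1$ (see context). Let $\check X_{N,\rho,\epsilon}(\tilde\xi^N)$ be the $\epsilon$-optimal solution set of the algorithm-augmented compromise decision problem and $X^*_\epsilon$ that of the true problem. If $\epsilon\le\epsilon_1$, then: 1. $$\mathbb E\big[\Delta(\check X_{N,\rho,\epsilon}(\tilde\xi^N),X^*_\epsilon)\big]\le\frac{D_XN_F}{\epsilon}\,\frac{8m-4}{m\,n^\lambda}+\frac{(\tau_1+\tau_2)D_X}{\epsilon}+2\sqrt{\epsilon/\rho},$$ where $\tau_1=\epsilon_1-\epsilon$ and $\tau_2=\epsilon_1+\frac{m-1}m\epsilon_2-\epsilon$. 2. Furthermore, if $\epsilon_1=\epsilon$, $\epsilon_2=0$, $\rho=n$, $D_X>0$ and $C=\frac{\epsilon^{3/2}}{D_X}+\frac{(4m-2)N_F}{m}$, then for every $t\ge0$ $$\Pr\Big\{\frac{\epsilon n^\lambda}{2D_X}\Delta(\check X_{N,\rho,\epsilon}(\tilde\xi^N),X^*_\epsilon)\ge C+t\Big\}\le m\exp\Big\{-\frac{m^2t^2}{2M_F^2(2m-1)^2}\Big\}.$$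
   Context: $\tilde\xi$ is a random vector on a probability space with values in $\Xi\subset\mathbb R^d$. $X\subset\mathbb R^p$ is a nonempty compact convex set contained in a cube of edge length $D$; $D_X=\max_{x,x'\in X}\|x-x'\|$, with $\|\cdot\|$ the Euclidean norm. $F:X\times\Xi\to\mathbb R$ is a Carathéodory function (continuous in $x$, measurable in $\xi$) such that: (i) for some $L_F$ and $\gamma\in(0,1]$, $|F(x,\xi)-F(y,\xi)|\le L_F\|x-y\|^\gamma$ for all $x,y\in X$, $\xi\in\Xi$; (ii) for some $M_F\in(0,\infty)$, $\sup_{x\in X,\xi\in\Xi}|F(x,\xi)|<M_F$; (iii) $F(\cdot,\xi)$ is convex on $X$ for every $\xi\in\Xi$. True problem: $f(x)=\mathbb E[F(x,\tilde\xi)]$, $\theta^*=\min_{x\in X}f(x)$, $X^*_\epsilon=\{x\in X:f(x)\le\theta^*+\epsilon\}$. Sampling: $\tilde\xi_1,\dots,\tilde\xi_N$ ($N=mn$) are i.i.d. copies of $\tilde\xi$; $\tilde\xi^N$ is the whole sample and $\tilde\xi^n_i=\{\tilde\xi_{(i-1)n+1},\dots,\tilde\xi_{in}\}$ the sample of replication $i$; untilded symbols are realizations. $f_n(x;\xi^n_i)=\frac1n\sum_{j=1}^nF(x,\xi_{(i-1)n+j})$. Algorithm output: for each replication $i$ an algorithm returns a function $\hat f_n(\cdot;\xi^n_i)$ and a point $\hat x_n(\xi^n_i)\in X$. Outer Approximation Condition: $\hat f_n(x;\xi^n_i)=\max_{\ell\in L}\{\alpha_\ell+\langle\beta_\ell,x\rangle\}$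 (finite index set $L$) and $\hat f_n(x;\xi^n_i)\le f_n(x;\xi^n_i)$ for all $x\in X$. Termination Condition: $\hat x_n(\xi^n_i)\in\arg\min_{x\in X}\hat f_n(x;\xi^n_i)$ and $f_n(\hat x_n(\xi^n_i);\xi^n_i)-\hat f_n(\hat x_n(\xi^n_i);\xi^n_i)\le\epsilon_1$. Augmentation: $$\check f_n(x;\xi^n_i)=\max\Big\{\hat f_n(x;\xi^n_i),\ \max_{j=1,\dots,m}\big\{f_n(\hat x_n(\xi^n_j);\xi^n_i)+\langle\upsilon_{ij},x-\hat x_n(\xi^n_j)\rangle-\epsilon_2\big\}\Big\},$$ where $\upsilon_{ij}$ is an $\epsilon_2$-subgradient of $f_n(\cdot;\xi^n_i)$ at $\hat x_n(\xi^n_j)$, i.e. $f_n(y;\xi^n_i)\ge f_n(\hat x_n(\xi^n_j);\xi^n_i)+\langle\upsilon_{ij},y-\hat x_n(\xi^n_j)\rangle-\epsilon_2$ for all $y\in X$ (such vectors are given). Algorithm-augmented compromise decision problem: minimize over $x\in X$ the function $G(x)=\frac1m\sum_{i=1}^m\check f_n(x;\xi^n_i)+\frac\rho2\big\|x-\frac1m\sum_{j=1}^m\hat x_n(\xi^n_j)\big\|^2$; $\check X_{N,\rho,\epsilon}(\xi^N)=\{x\in X:G(x)\le\min_XG+\epsilon\}$. Pessimistic distance: $\Delta(A,B)=\sup_{a\in A}\inf_{b\in B}\|a-b\|$. Constant: $N_F=L_FD^\gamma p^{\gamma/2}+M_F\sqrt{2\log2}+\dfrac{M_Fp^{1/2}}{\sqrt{\gamma(1-2\lambda)e}}$.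 All selections and random quantities whose expectation or probability is taken are assumed measurable. *)

theory Defs
  imports "HOL-Probability.Probability"
begin

text \<open>A cube is not required to be parallel to the coordinate axes.\<close>

definition is_cube :: "real \<Rightarrow> (real^'p) set \<Rightarrow> bool" where
  "is_cube D Q \<longleftrightarrow> 0 \<le> D \<and>
     (\<exists>a (T :: real^'p \<Rightarrow> real^'p). orthogonal_transformation T \<and>
        Q = (\<lambda>y. a + T y) ` cbox 0 (\<chi> i. D))"

text \<open>In the two definitions below the infimum stands for the minimum over the compact set
  \<open>X\<close>; it is attained for every objective to which they are applied.\<close>

definition opt_value :: "'x set \<Rightarrow> ('x \<Rightarrow> real) \<Rightarrow> real" where
  "opt_value X h = (INF x\<in>X. h x)"

definition eps_opt_set :: "'x set \<Rightarrow> ('x \<Rightarrow> real) \<Rightarrow> real \<Rightarrow> 'x set" where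
  "eps_opt_set X h \<epsilon> = {x \<in> X. h x \<le> opt_value X h + \<epsilon>}"

definition pessimistic_dist :: "'x::real_normed_vector set \<Rightarrow> 'x set \<Rightarrow> real" where
  "pessimistic_dist A B = (SUP a\<in>A. INF b\<in>B. norm (a - b))"

definition caratheodory_on ::
    "'x::topological_space set \<Rightarrow> 's::topological_space set \<Rightarrow> ('x \<Rightarrow> 's \<Rightarrow> real) \<Rightarrow> bool" where
  "caratheodory_on X \<Xi> F \<longleftrightarrow>
     (\<forall>\<xi>\<in>\<Xi>. continuous_on X (\<lambda>x. F x \<xi>)) \<and>
     (\<forall>x\<in>X. F x \<in> borel_measurable (restrict_space borel \<Xi>))"

definition true_obj :: "'a measure \<Rightarrow> ('a \<Rightarrow> 's) \<Rightarrow> ('x \<Rightarrow> 's \<Rightarrow> real) \<Rightarrow> 'x \<Rightarrow> real" where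
  "true_obj M \<xi> F x = (LINT \<omega>|M. F x (\<xi> \<omega>))"

text \<open>A realization of the whole sample is a function \<open>z\<close> on \<open>{1..m * n}\<close>; replications are
  numbered \<open>i = 1, \<dots>, m\<close>. Restricting to \<open>{1..n}\<close> makes the value depend on the sample of
  replication \<open>i\<close> only.\<close>

definition replication :: "nat \<Rightarrow> nat \<Rightarrow> (nat \<Rightarrow> 's) \<Rightarrow> nat \<Rightarrow> 's" where
  "replication n i z = (\<lambda>j\<in>{1..n}. z ((i - 1) * n + j))"

definition sample_avg :: "('x \<Rightarrow> 's \<Rightarrow> real) \<Rightarrow> nat \<Rightarrow> (nat \<Rightarrow> 's) \<Rightarrow> 'x \<Rightarrow> real" where
  "sample_avg F n s x = (1 / real n) * (\<Sum>j=1..n. F x (s j))"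

definition outer_approximation ::
    "'x::real_inner set \<Rightarrow> ('x \<Rightarrow> real) \<Rightarrow> ('x \<Rightarrow> real) \<Rightarrow> bool" where
  "outer_approximation X h g \<longleftrightarrow>
     (\<exists>(L::nat set) \<alpha> \<beta>. finite L \<and> L \<noteq> {} \<and> (\<forall>x. g x = (MAX l\<in>L. \<alpha> l + \<beta> l \<bullet> x))) \<and>
     (\<forall>x\<in>X. g x \<le> h x)"

definition termination_condition ::
    "'x set \<Rightarrow> ('x \<Rightarrow> real) \<Rightarrow> ('x \<Rightarrow> real) \<Rightarrow> real \<Rightarrow> 'x \<Rightarrow> bool" where
  "termination_condition X h g \<epsilon>\<^sub>1 x \<longleftrightarrow> is_arg_min g (\<lambda>y. y \<in> X) x \<and> h x - g x \<le> \<epsilon>\<^sub>1"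

definition eps_subgradient ::
    "'x::real_inner set \<Rightarrow> ('x \<Rightarrow> real) \<Rightarrow> real \<Rightarrow> 'x \<Rightarrow> 'x \<Rightarrow> bool" where
  "eps_subgradient X h \<epsilon> x v \<longleftrightarrow> (\<forall>y\<in>X. h y \<ge> h x + v \<bullet> (y - x) - \<epsilon>)"

text \<open>\<open>fhat\<close> and \<open>xhat\<close> map the sample of one replication to the output of the algorithm;
  the subgradients \<open>\<upsilon> i j\<close> may depend on the whole sample \<open>z\<close>.\<close>

definition augmented ::
    "('x::real_inner \<Rightarrow> 's \<Rightarrow> real) \<Rightarrow> nat \<Rightarrow> nat \<Rightarrow> real \<Rightarrow> ((nat \<Rightarrow> 's) \<Rightarrow> 'x \<Rightarrow> real) \<Rightarrow>
     ((nat \<Rightarrow> 's) \<Rightarrow> 'x) \<Rightarrow> (nat \<Rightarrow> nat \<Rightarrow> (nat \<Rightarrow> 's) \<Rightarrow> 'x) \<Rightarrow> (nat \<Rightarrow> 's) \<Rightarrow> nat \<Rightarrow> 'x \<Rightarrow> real" where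
  "augmented F m n \<epsilon>\<^sub>2 fhat xhat \<upsilon> z i x =
     max (fhat (replication n i z) x)
       (MAX j\<in>{1..m}.
          sample_avg F n (replication n i z) (xhat (replication n j z))
            + \<upsilon> i j z \<bullet> (x - xhat (replication n j z)) - \<epsilon>\<^sub>2)"

definition compromise_obj ::
    "('x::real_inner \<Rightarrow> 's \<Rightarrow> real) \<Rightarrow> nat \<Rightarrow> nat \<Rightarrow> real \<Rightarrow> real \<Rightarrow> ((nat \<Rightarrow> 's) \<Rightarrow> 'x \<Rightarrow> real) \<Rightarrow>
     ((nat \<Rightarrow> 's) \<Rightarrow> 'x) \<Rightarrow> (nat \<Rightarrow> nat \<Rightarrow> (nat \<Rightarrow> 's) \<Rightarrow> 'x) \<Rightarrow> (nat \<Rightarrow> 's) \<Rightarrow> 'x \<Rightarrow> real" where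
  "compromise_obj F m n \<rho> \<epsilon>\<^sub>2 fhat xhat \<upsilon> z x =
     (1 / real m) * (\<Sum>i=1..m. augmented F m n \<epsilon>\<^sub>2 fhat xhat \<upsilon> z i x)
       + \<rho> / 2 * (norm (x - (1 / real m) *\<^sub>R (\<Sum>j=1..m. xhat (replication n j z))))\<^sup>2"

definition N_const :: "real \<Rightarrow> real \<Rightarrow> real \<Rightarrow> real \<Rightarrow> nat \<Rightarrow> real \<Rightarrow> real" where
  "N_const L\<^sub>F \<gamma> M\<^sub>F D p lam =
     L\<^sub>F * D powr \<gamma> * real p powr (\<gamma> / 2) + M\<^sub>F * sqrt (2 * ln 2)
       + M\<^sub>F * sqrt (real p) / sqrt (\<gamma> * (1 - 2 * lam) * exp 1)"

end

theory Submission
  imports Defs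
begin

text \<open>
  Let \<open>\<delta>\<^sub>i = sup\<^sub>x |f\<^sub>n(x; \<xi>\<^sub>i) - f(x)|\<close>, with average \<open>\<delta>\<close>, and let \<open>y\<close> be the average of the
  replication solutions. Termination and convexity give \<open>f(y) \<le> \<theta> + \<epsilon>\<^sub>1 + 2\<delta>\<close>, and comparing the
  compromise objective at an \<open>\<epsilon>\<close>-optimal \<open>x\<close> with its value at \<open>y\<close> gives
  \<open>\<rho>/2 |x - y|\<^sup>2 \<le> \<epsilon> + \<epsilon>\<^sub>1 + 2\<delta>(m - 1)/m\<close>. Since a point whose value exceeds \<open>\<theta> + \<epsilon>\<close> by \<open>\<eta>\<close> has
  distance at most \<open>D\<^sub>X \<eta>/\<epsilon>\<close> from the \<open>\<epsilon>\<close>-optimal set, the pessimistic distance is bounded by an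
  affine function of \<open>\<delta>\<close>.

  Each \<open>\<delta>\<^sub>i\<close> is at most \<open>2 L r\<^sup>\<gamma>\<close> plus the maximal deviation on a finite \<open>r\<close>-net of \<open>X\<close>. Hoeffding's
  lemma bounds the moment generating function of that maximum, hence both its mean and its tail.
  The constant \<open>N\<^sub>F\<close> corresponds to a net with about \<open>n\<close> to the power \<open>1/(2\<gamma>)\<close> cells in each
  coordinate; its factor 2 leaves enough room to avoid symmetrization and bounded differences.
\<close>

section \<open>Deviation of the mean over finitely many functions\<close>

text \<open>Independence turns the expectation of the product into a product of expectations, and
  Hoeffding's lemma bounds each factor. The range has length \<open>2 * B\<close>, so its constant
  is \<open>(2 * B)\<^sup>2 / 8 = B\<^sup>2 / 2\<close>.\<close>

lemma (in prob_space) centered_sum_mgf: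
  fixes Y :: "'i \<Rightarrow> 'a \<Rightarrow> real"
  assumes fin: "finite J" and ind: "indep_vars (\<lambda>_. borel) Y J"
    and bd: "\<And>k \<omega>. k \<in> J \<Longrightarrow> \<omega> \<in> space M \<Longrightarrow> \<bar>Y k \<omega>\<bar> \<le> B"
    and mean: "\<And>k. k \<in> J \<Longrightarrow> expectation (Y k) = \<mu>"
    and l: "0 < l"
  shows "expectation (\<lambda>\<omega>. exp (l * (\<Sum>k\<in>J. Y k \<omega> - \<mu>))) \<le> exp (real (card J) * (l * B)\<^sup>2 / 2)"
proof -
  have rv[measurable]: "Y k \<in> borel_measurable M" if "k \<in> J" for k
    using ind that unfolding indep_vars_def by auto
  have int: "integrable M (\<lambda>\<omega>. exp (l * (Y k \<omega> - \<mu>)))" if k: "k \<in> J" for k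
  proof (rule integrable_const_bound)
    show "AE \<omega> in M. norm (exp (l * (Y k \<omega> - \<mu>))) \<le> exp (l * (B - \<mu>))"
      using l bd[OF k] by (intro AE_I2) (auto simp: abs_le_iff)
  qed (use k in measurable)
  have each: "expectation (\<lambda>\<omega>. exp (l * (Y k \<omega> - \<mu>))) \<le> exp ((l * B)\<^sup>2 / 2)" if k: "k \<in> J" for k
  proof -
    interpret interval_bounded_random_variable M "Y k" "- B" B
    proof unfold_locales
      show "AE \<omega> in M. Y k \<omega> \<in> {- B..B}"
        using bd[OF k] by (intro AE_I2) (simp add: abs_le_iff minus_le_iff)
    qed (rule rv[OF k])
    have "ennreal (expectation (\<lambda>\<omega>. exp (l * (Y k \<omega> - \<mu>)))) =
        (\<integral>\<^sup>+\<omega>. exp (l * (Y k \<omega> - expectation (Y k))) \<partial>M)"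
      using int[OF k] by (subst nn_integral_eq_integral) (auto simp: mean[OF k])
    also have "\<dots> \<le> ennreal (exp (l\<^sup>2 * ((B - expectation (Y k)) - (- B - expectation (Y k)))\<^sup>2 / 8))"
      using Hoeffdings_lemma_nn_integral[OF l] by simp
    also have "l\<^sup>2 * ((B - expectation (Y k)) - (- B - expectation (Y k)))\<^sup>2 / 8 = (l * B)\<^sup>2 / 2"
      by (simp add: power2_eq_square)
    finally show ?thesis
      by (subst (asm) ennreal_le_iff) auto
  qed
  have "expectation (\<lambda>\<omega>. exp (l * (\<Sum>k\<in>J. Y k \<omega> - \<mu>)))
      = expectation (\<lambda>\<omega>. \<Prod>k\<in>J. exp (l * (Y k \<omega> - \<mu>)))"
    by (simp add: sum_distrib_left exp_sum[OF fin])
  also have "\<dots> = (\<Prod>k\<in>J. expectation (\<lambda>\<omega>. exp (l * (Y k \<omega> - \<mu>))))"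
    by (intro indep_vars_lebesgue_integral fin int indep_vars_compose2[OF ind]) auto
  also have "\<dots> \<le> (\<Prod>k\<in>J. exp ((l * B)\<^sup>2 / 2))"
    by (intro prod_mono) (auto intro!: each integral_nonneg)
  also have "\<dots> = exp (real (card J) * (l * B)\<^sup>2 / 2)"
    by (simp add: exp_of_nat_mult[symmetric])
  finally show ?thesis .
qed

text \<open>The tangent inequality \<open>exp (x - b) \<ge> 1 + x - b\<close> takes the place of
  Jensen's inequality for the logarithm. The chosen \<open>l\<close> minimizes
  \<open>ln \<kappa> / l + l * s\<^sup>2 / 2\<close>, and \<open>b\<close> is the logarithm of the
  moment bound at this \<open>l\<close>.\<close>

lemma (in prob_space) expectation_le_of_mgf:
  fixes W :: "'a \<Rightarrow> real"
  assumes int: "integrable M W" and inte: "\<And>l. 0 < l \<Longrightarrow> integrable M (\<lambda>\<omega>. exp (l * W \<omega>))"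
    and mgf: "\<And>l. 0 < l \<Longrightarrow> expectation (\<lambda>\<omega>. exp (l * W \<omega>)) \<le> \<kappa> * exp ((l * s)\<^sup>2 / 2)"
    and \<kappa>: "1 < \<kappa>" and s: "0 < s"
  shows "expectation W \<le> s * sqrt (2 * ln \<kappa>)"
proof -
  define b where "b = 2 * ln \<kappa>"
  define l where "l = sqrt b / s"
  have b: "0 < b" unfolding b_def using \<kappa> by simp
  have l: "0 < l" unfolding l_def using b s by simp
  have ls: "(l * s)\<^sup>2 = b" unfolding l_def using b s by simp
  have "l * expectation W = expectation (\<lambda>\<omega>. l * W \<omega>)" by simp
  also have "\<dots> \<le> expectation (\<lambda>\<omega>. (b - 1) + exp (- b) * exp (l * W \<omega>))"
  proof (intro integral_mono)
    fix \<omega>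
    show "l * W \<omega> \<le> (b - 1) + exp (- b) * exp (l * W \<omega>)"
      using exp_ge_add_one_self[of "l * W \<omega> - b"] by (simp add: exp_diff exp_minus field_simps)
  qed (use int inte[OF l] in auto)
  also have "\<dots> = (b - 1) + exp (- b) * expectation (\<lambda>\<omega>. exp (l * W \<omega>))"
    using inte[OF l] by (simp add: prob_space)
  also have "\<dots> \<le> (b - 1) + exp (- b) * (\<kappa> * exp ((l * s)\<^sup>2 / 2))"
    using mgf[OF l] by simp
  \<comment> \<open>Both \<open>\<kappa>\<close> and the Gaussian factor equal
    \<open>exp (b / 2)\<close>, so their product cancels \<open>exp (- b)\<close>.\<close>
  also have "\<dots> = (b - 1) + exp (- b) * (exp (b / 2) * exp (b / 2))"
    using \<kappa> by (simp add: ls b_def)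
  also have "\<dots> = b"
    by (simp flip: exp_add)
  finally have "expectation W \<le> b / l" using l by (simp add: field_simps)
  also have "b / l = s * sqrt b" unfolding l_def using b s
    by (simp add: field_simps)
  finally show ?thesis by (simp add: b_def)
qed

text \<open>Chernoff bound at level \<open>a\<close>, with \<open>l = a / s\<^sup>2\<close>
  minimizing the exponent. The shift \<open>s * sqrt (2 * ln \<kappa>)\<close> absorbs the prefactor
  \<open>\<kappa>\<close>, because the square of \<open>a\<close> dominates the sum of the squares
  of its two terms.\<close>

lemma (in prob_space) tail_le_of_mgf:
  fixes W :: "'a \<Rightarrow> real"
  assumes inte: "\<And>l. 0 < l \<Longrightarrow> integrable M (\<lambda>\<omega>. exp (l * W \<omega>))"
    and mgf: "\<And>l. 0 < l \<Longrightarrow> expectation (\<lambda>\<omega>. exp (l * W \<omega>)) \<le> \<kappa> * exp ((l * s)\<^sup>2 / 2)"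
    and \<kappa>: "1 < \<kappa>" and s: "0 < s" and u: "0 \<le> u"
  shows "prob {\<omega> \<in> space M. s * sqrt (2 * ln \<kappa>) + u \<le> W \<omega>} \<le> exp (- (u\<^sup>2 / (2 * s\<^sup>2)))"
proof -
  define a where "a = s * sqrt (2 * ln \<kappa>) + u"
  define l where "l = a / s\<^sup>2"
  have a: "0 < a" unfolding a_def using \<kappa> s u by (intro add_pos_nonneg mult_pos_pos) auto
  have l: "0 < l" unfolding l_def using a s by simp
  have sq: "2 * s\<^sup>2 * ln \<kappa> + u\<^sup>2 \<le> a\<^sup>2"
  proof -
    have "0 \<le> 2 * (s * sqrt (2 * ln \<kappa>)) * u" using \<kappa> s u by (intro mult_nonneg_nonneg) auto
    then show ?thesis unfolding a_def power2_sum using \<kappa> by (simp add: power_mult_distrib)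
  qed
  have "{\<omega> \<in> space M. a \<le> W \<omega>} = {\<omega> \<in> space M. exp (l * a) \<le> exp (l * W \<omega>)}"
    using l by auto
  also have "prob \<dots> \<le> expectation (\<lambda>\<omega>. exp (l * W \<omega>)) / exp (l * a)"
    by (rule integral_Markov_inequality_measure[OF inte[OF l], of "{}"]) auto
  also have "\<dots> \<le> \<kappa> * exp ((l * s)\<^sup>2 / 2) / exp (l * a)"
    by (intro divide_right_mono mgf l) auto
  also have "\<dots> = exp (ln \<kappa> + (l * s)\<^sup>2 / 2 - l * a)"
    using \<kappa> by (simp add: exp_add exp_diff)
  also have "ln \<kappa> + (l * s)\<^sup>2 / 2 - l * a = ln \<kappa> - a\<^sup>2 / (2 * s\<^sup>2)"
    unfolding l_def using s by (simp add: field_simps power2_eq_square)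
  also have "exp \<dots> \<le> exp (- (u\<^sup>2 / (2 * s\<^sup>2)))"
  proof -
    have "ln \<kappa> - a\<^sup>2 / (2 * s\<^sup>2) = (2 * s\<^sup>2 * ln \<kappa> - a\<^sup>2) / (2 * s\<^sup>2)"
      using s by (simp add: diff_divide_distrib)
    also have "\<dots> \<le> - u\<^sup>2 / (2 * s\<^sup>2)"
      using sq s by (intro divide_right_mono) auto
    finally show ?thesis by simp
  qed
  finally show ?thesis by (simp add: a_def)
qed

text \<open>A union bound at the level of exponentials: the exponential of the maximum is one of the
  \<open>2 * card C\<close> terms belonging to the signed variables, hence at most their
  sum.\<close>

lemma (in prob_space) Max_abs_mgf:
  fixes Z :: "'c \<Rightarrow> 'a \<Rightarrow> real"
  assumes fin: "finite C" and ne: "C \<noteq> {}"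
    and [measurable]: "\<And>c. c \<in> C \<Longrightarrow> Z c \<in> borel_measurable M"
    and bd: "\<And>c \<omega>. c \<in> C \<Longrightarrow> \<omega> \<in> space M \<Longrightarrow> \<bar>Z c \<omega>\<bar> \<le> B"
    and mgf: "\<And>c. c \<in> C \<Longrightarrow> expectation (\<lambda>\<omega>. exp (l * Z c \<omega>)) \<le> v"
      "\<And>c. c \<in> C \<Longrightarrow> expectation (\<lambda>\<omega>. exp (l * - Z c \<omega>)) \<le> v"
    and l: "0 < l"
  shows "integrable M (\<lambda>\<omega>. exp (l * (MAX c\<in>C. \<bar>Z c \<omega>\<bar>)))"
    and "expectation (\<lambda>\<omega>. exp (l * (MAX c\<in>C. \<bar>Z c \<omega>\<bar>))) \<le> 2 * real (card C) * v"
proof -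
  have Maxm[measurable]: "(\<lambda>\<omega>. MAX c\<in>C. \<bar>Z c \<omega>\<bar>) \<in> borel_measurable M"
    using fin by measurable
  show int: "integrable M (\<lambda>\<omega>. exp (l * (MAX c\<in>C. \<bar>Z c \<omega>\<bar>)))"
  proof (rule integrable_const_bound)
    show "AE \<omega> in M. norm (exp (l * (MAX c\<in>C. \<bar>Z c \<omega>\<bar>))) \<le> exp (l * B)"
      using l bd fin ne by (intro AE_I2) (auto intro!: mult_left_mono)
  qed measurable
  have int1: "integrable M (\<lambda>\<omega>. exp (l * Z c \<omega>))" "integrable M (\<lambda>\<omega>. exp (l * - Z c \<omega>))"
    if c: "c \<in> C" for c
  proof -
    have "l * Z c \<omega> \<le> l * B" "l * - Z c \<omega> \<le> l * B" if "\<omega> \<in> space M" for \<omega>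
      using bd[OF c that] l by (intro mult_left_mono; simp)+
    then show "integrable M (\<lambda>\<omega>. exp (l * Z c \<omega>))" "integrable M (\<lambda>\<omega>. exp (l * - Z c \<omega>))"
      using c by (auto intro!: integrable_const_bound[where B = "exp (l * B)"] simp del: mult_minus_right)
  qed
  have "expectation (\<lambda>\<omega>. exp (l * (MAX c\<in>C. \<bar>Z c \<omega>\<bar>)))
      \<le> expectation (\<lambda>\<omega>. \<Sum>c\<in>C. exp (l * Z c \<omega>) + exp (l * - Z c \<omega>))"
  proof (intro integral_mono int Bochner_Integration.integrable_sum Bochner_Integration.integrable_add int1)
    fix \<omega>
    have "(MAX c\<in>C. \<bar>Z c \<omega>\<bar>) \<in> (\<lambda>c. \<bar>Z c \<omega>\<bar>) ` C"
      using fin ne by (intro Max_in) auto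
    then obtain c where c: "c \<in> C" "(MAX c\<in>C. \<bar>Z c \<omega>\<bar>) = \<bar>Z c \<omega>\<bar>" by auto
    have "exp (l * \<bar>Z c \<omega>\<bar>) \<le> exp (l * Z c \<omega>) + exp (l * - Z c \<omega>)"
      by (cases "0 \<le> Z c \<omega>") (simp_all add: abs_if)
    also have "\<dots> \<le> (\<Sum>c\<in>C. exp (l * Z c \<omega>) + exp (l * - Z c \<omega>))"
      by (rule member_le_sum[OF c(1)]) (auto simp: fin intro: add_nonneg_nonneg)
    finally show "exp (l * (MAX c\<in>C. \<bar>Z c \<omega>\<bar>)) \<le> (\<Sum>c\<in>C. exp (l * Z c \<omega>) + exp (l * - Z c \<omega>))"
      using c by simp
  qed auto
  also have "\<dots> = (\<Sum>c\<in>C. expectation (\<lambda>\<omega>. exp (l * Z c \<omega>)) + expectation (\<lambda>\<omega>. exp (l * - Z c \<omega>)))"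
    using int1 by (subst Bochner_Integration.integral_sum) (auto simp del: mult_minus_right)
  also have "\<dots> \<le> (\<Sum>c\<in>C. v + v)"
    by (intro sum_mono add_mono mgf)
  finally show "expectation (\<lambda>\<omega>. exp (l * (MAX c\<in>C. \<bar>Z c \<omega>\<bar>))) \<le> 2 * real (card C) * v" by simp
qed

text \<open>The maximal deviation has a moment bound with prefactor \<open>2 * card C\<close> and
  scale \<open>B / sqrt (card J)\<close>. Mean and tail are both read off from it, with the same
  offset \<open>a\<close>.\<close>

lemma (in prob_space)
  fixes Y :: "'c \<Rightarrow> 'i \<Rightarrow> 'a \<Rightarrow> real"
  assumes finC: "finite C" and ne: "C \<noteq> {}" and fin: "finite J" and J: "J \<noteq> {}"
    and ind: "\<And>c. c \<in> C \<Longrightarrow> indep_vars (\<lambda>_. borel) (Y c) J"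
    and bd: "\<And>c k \<omega>. c \<in> C \<Longrightarrow> k \<in> J \<Longrightarrow> \<omega> \<in> space M \<Longrightarrow> \<bar>Y c k \<omega>\<bar> \<le> B"
    and mean: "\<And>c k. c \<in> C \<Longrightarrow> k \<in> J \<Longrightarrow> expectation (Y c k) = \<mu> c"
    and B: "0 < B"
  defines "W \<equiv> \<lambda>\<omega>. MAX c\<in>C. \<bar>(1 / real (card J)) * (\<Sum>k\<in>J. Y c k \<omega>) - \<mu> c\<bar>"
    and "a \<equiv> B * sqrt (2 * ln (2 * real (card C))) / sqrt (real (card J))"
  shows integrable_max_deviation: "integrable M W"
    and expectation_max_deviation: "expectation W \<le> a"
    and tail_max_deviation:
      "0 \<le> u \<Longrightarrow> prob {\<omega> \<in> space M. a + u \<le> W \<omega>} \<le> exp (- (real (card J) * u\<^sup>2 / (2 * B\<^sup>2)))"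
proof -
  define N where "N = real (card J)"
  have N: "0 < N" unfolding N_def using fin J by (simp add: card_gt_0_iff)
  have rv[measurable]: "Y c k \<in> borel_measurable M" if "c \<in> C" "k \<in> J" for c k
    using ind[OF that(1)] that unfolding indep_vars_def by auto
  define Z where "Z c \<omega> = (1 / N) * (\<Sum>k\<in>J. Y c k \<omega>) - \<mu> c" for c \<omega>
  have Z_eq: "Z c \<omega> = (1 / N) * (\<Sum>k\<in>J. Y c k \<omega> - \<mu> c)" for c \<omega>
    unfolding Z_def using N by (simp add: sum_subtractf N_def right_diff_distrib)
  have Z[measurable]: "Z c \<in> borel_measurable M" if "c \<in> C" for c
    unfolding Z_def using that by measurable
  have \<mu>: "\<bar>\<mu> c\<bar> \<le> B" if "c \<in> C" for c
  proof -
    obtain k where k: "k \<in> J" using J by auto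
    have "\<bar>expectation (Y c k)\<bar> \<le> expectation (\<lambda>\<omega>. \<bar>Y c k \<omega>\<bar>)" by (rule integral_abs_bound)
    also have "\<dots> \<le> expectation (\<lambda>\<omega>. B)"
      using bd[OF that k] that k B
      by (intro integral_mono integrable_const_bound[where B = B]) auto
    finally show ?thesis by (simp add: mean that k prob_space)
  qed
  have Zbd: "\<bar>Z c \<omega>\<bar> \<le> 2 * B" if "c \<in> C" "\<omega> \<in> space M" for c \<omega>
  proof -
    have "\<bar>\<Sum>k\<in>J. Y c k \<omega>\<bar> \<le> (\<Sum>k\<in>J. B)"
      using bd that by (intro order_trans[OF sum_abs] sum_mono) auto
    then have "\<bar>(1 / N) * (\<Sum>k\<in>J. Y c k \<omega>)\<bar> \<le> B"
      using N by (simp add: abs_mult N_def[symmetric] field_simps)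
    then show ?thesis unfolding Z_def using \<mu>[OF that(1)] by linarith
  qed
  \<comment> \<open>Averaging replaces \<open>l\<close> by \<open>l / N\<close> in each of the
    \<open>N\<close> factors, and \<open>N * (l * B / N)\<^sup>2 = (l * s)\<^sup>2\<close> for this
    \<open>s\<close>.\<close>
  define s where "s = B / sqrt N"
  have s: "0 < s" unfolding s_def using N B by simp
  have mgf: "expectation (\<lambda>\<omega>. exp (l * Z c \<omega>)) \<le> exp ((l * s)\<^sup>2 / 2)"
    "expectation (\<lambda>\<omega>. exp (l * - Z c \<omega>)) \<le> exp ((l * s)\<^sup>2 / 2)"
    if c: "c \<in> C" and l: "0 < l" for c l
  proof -
    have lN: "0 < l / N" using l N by simp
    have *: "N * (l * B / N)\<^sup>2 = (l * s)\<^sup>2" unfolding s_def using N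
      by (simp add: power_mult_distrib power_divide power2_eq_square)
    show "expectation (\<lambda>\<omega>. exp (l * Z c \<omega>)) \<le> exp ((l * s)\<^sup>2 / 2)"
      using centered_sum_mgf[OF fin ind[OF c] bd[OF c] mean[OF c] lN]
      by (simp add: Z_eq * N_def[symmetric])
    \<comment> \<open>The lower deviation is the upper deviation of the variables
      \<open>- Y c k\<close>, which have mean \<open>- \<mu> c\<close>.\<close>
    have "(\<Sum>k\<in>J. - Y c k \<omega> - - \<mu> c) = - (\<Sum>k\<in>J. Y c k \<omega> - \<mu> c)" for \<omega>
      by (simp add: sum_negf[symmetric])
    moreover have "indep_vars (\<lambda>_. borel) (\<lambda>k \<omega>. - Y c k \<omega>) J"
      by (rule indep_vars_compose2[OF ind[OF c]]) auto
    ultimately show "expectation (\<lambda>\<omega>. exp (l * - Z c \<omega>)) \<le> exp ((l * s)\<^sup>2 / 2)"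
      using centered_sum_mgf[OF fin, of "\<lambda>k \<omega>. - Y c k \<omega>" B "- \<mu> c", OF _ _ _ lN] bd[OF c] mean[OF c]
      by (simp add: Z_eq * N_def[symmetric])
  qed
  have W: "W = (\<lambda>\<omega>. MAX c\<in>C. \<bar>Z c \<omega>\<bar>)" unfolding W_def Z_def N_def ..
  have inte: "integrable M (\<lambda>\<omega>. exp (l * W \<omega>))"
    and mgfW: "expectation (\<lambda>\<omega>. exp (l * W \<omega>)) \<le> 2 * real (card C) * exp ((l * s)\<^sup>2 / 2)"
    if "0 < l" for l
    unfolding W
    using Max_abs_mgf[where Z = Z and B = "2 * B", OF finC ne Z Zbd mgf(1)[OF _ that] mgf(2)[OF _ that] that]
    by auto
  show int: "integrable M W"
  proof (rule integrable_const_bound)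
    show "W \<in> borel_measurable M" unfolding W using finC by measurable
    show "AE \<omega> in M. norm (W \<omega>) \<le> 2 * B"
    proof (intro AE_I2)
      fix \<omega> assume \<omega>: "\<omega> \<in> space M"
      have "W \<omega> \<in> (\<lambda>c. \<bar>Z c \<omega>\<bar>) ` C"
        unfolding W using finC ne by (intro Max_in) auto
      then show "norm (W \<omega>) \<le> 2 * B" using Zbd[OF _ \<omega>] by auto
    qed
  qed
  have \<kappa>: "1 < 2 * real (card C)" using finC ne card_gt_0_iff[of C] by linarith
  have a: "a = s * sqrt (2 * ln (2 * real (card C)))" unfolding a_def s_def N_def by simp
  show "expectation W \<le> a"
    unfolding a by (rule expectation_le_of_mgf[OF int inte mgfW \<kappa> s])
  show "prob {\<omega> \<in> space M. a + u \<le> W \<omega>} \<le> exp (- (real (card J) * u\<^sup>2 / (2 * B\<^sup>2)))" if "0 \<le> u"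
    using tail_le_of_mgf[OF inte mgfW \<kappa> s that] N
    by (simp add: a s_def power_divide N_def[symmetric] mult.commute)
qed

section \<open>Nets of a cube and the constant of the theorem\<close>

lemma grid_coordinate:
  fixes D :: real and \<nu> :: nat
  assumes "0 \<le> D" "0 < \<nu>"
  obtains h :: "real \<Rightarrow> nat"
  where "\<And>y. 0 \<le> y \<Longrightarrow> y \<le> D \<Longrightarrow> h y < \<nu>"
    and "\<And>y y'. \<lbrakk>0 \<le> y; y \<le> D; 0 \<le> y'; y' \<le> D; h y = h y'\<rbrakk> \<Longrightarrow> \<bar>y - y'\<bar> \<le> D / real \<nu>"
proof
  \<comment> \<open>Cells are closed on the right, so \<open>y = D\<close> falls in the last one;
    truncated subtraction puts \<open>y = 0\<close> in cell 0. For \<open>D = 0\<close> the quotient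
    is 0 and there is a single cell.\<close>
  define h where "h y = nat \<lceil>y * real \<nu> / D\<rceil> - 1" for y
  have up: "y * real \<nu> / D \<le> real \<nu>" if "0 \<le> y" "y \<le> D" for y
    using that by (cases "D = 0") (auto simp: field_simps mult_right_mono)
  show "h y < \<nu>" if "0 \<le> y" "y \<le> D" for y
  proof -
    have "\<lceil>y * real \<nu> / D\<rceil> \<le> int \<nu>" using up[OF that] by (simp add: ceiling_le_iff)
    then show ?thesis unfolding h_def using assms(2) by linarith
  qed
  have h: "real (h y) \<le> y * real \<nu> / D" "y * real \<nu> / D \<le> real (h y) + 1"
    if "0 \<le> y" "y \<le> D" for y
  proof -
    have "0 \<le> y * real \<nu> / D" using that assms by simp
    then show "real (h y) \<le> y * real \<nu> / D" "y * real \<nu> / D \<le> real (h y) + 1"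
      unfolding h_def by linarith+
  qed
  show "\<bar>y - y'\<bar> \<le> D / real \<nu>"
    if y: "0 \<le> y" "y \<le> D" and y': "0 \<le> y'" "y' \<le> D" and eq: "h y = h y'" for y y'
  proof (cases "D = 0")
    case True
    then show ?thesis using y y' by simp
  next
    case False
    then have D: "0 < D" using assms by simp
    have "\<bar>y * real \<nu> / D - y' * real \<nu> / D\<bar> \<le> 1"
      using h[OF y] h[OF y'] eq by linarith
    also have "y * real \<nu> / D - y' * real \<nu> / D = (y - y') * (real \<nu> / D)"
      by (simp add: algebra_simps diff_divide_distrib)
    finally have "\<bar>y - y'\<bar> * (real \<nu> / D) \<le> 1" using D assms by (simp add: abs_mult)
    then show ?thesis using D assms by (simp add: field_simps)
  qed
qed

text \<open>One point of \<open>X\<close> is kept from each cell that meets \<open>X\<close>. The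
  net then lies in \<open>X\<close>, where the Hoelder condition can be applied. Distances are
  computed in the coordinates of the cube, since \<open>T\<close> is an isometry.\<close>

lemma cube_net:
  fixes X :: "(real^'p) set" and \<nu> :: nat
  assumes Q: "is_cube D Q" "X \<subseteq> Q" and \<nu>: "0 < \<nu>"
  obtains C where "finite C" "C \<subseteq> X" "card C \<le> \<nu> ^ CARD('p)"
    and "\<And>x. x \<in> X \<Longrightarrow> \<exists>c\<in>C. norm (x - c) \<le> D / real \<nu> * sqrt (real CARD('p))"
proof -
  obtain a and T :: "real^'p \<Rightarrow> real^'p" where D: "0 \<le> D" and T: "orthogonal_transformation T"
    and Q_eq: "Q = (\<lambda>y. a + T y) ` cbox 0 (\<chi> i. D)"
    using Q(1) unfolding is_cube_def by auto
  have "\<forall>x\<in>X. \<exists>y. (\<forall>i. 0 \<le> y $ i \<and> y $ i \<le> D) \<and> x = a + T y"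
    using Q(2) unfolding Q_eq by (fastforce simp: mem_box_cart)
  then obtain Y where Y: "\<And>x i. x \<in> X \<Longrightarrow> 0 \<le> Y x $ i" "\<And>x i. x \<in> X \<Longrightarrow> Y x $ i \<le> D"
    "\<And>x. x \<in> X \<Longrightarrow> x = a + T (Y x)" by metis
  obtain h where h: "\<And>y. 0 \<le> y \<Longrightarrow> y \<le> D \<Longrightarrow> h y < \<nu>"
    "\<And>y y'. \<lbrakk>0 \<le> y; y \<le> D; 0 \<le> y'; y' \<le> D; h y = h y'\<rbrakk> \<Longrightarrow> \<bar>y - y'\<bar> \<le> D / real \<nu>"
    by (rule grid_coordinate[OF D \<nu>]) blast
  define g where "g x = (\<lambda>i. h (Y x $ i))" for x
  have sub: "g ` X \<subseteq> PiE UNIV (\<lambda>_. {..<\<nu>})"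
    unfolding g_def using h(1) Y by auto
  have fin: "finite (PiE (UNIV::'p set) (\<lambda>_. {..<\<nu>}))" by (intro finite_PiE) auto
  define C where "C = inv_into X g ` g ` X"
  show thesis
  proof (rule that[of C])
    show "finite C" unfolding C_def using finite_subset[OF sub fin] by simp
    show "C \<subseteq> X" unfolding C_def by (auto intro: inv_into_into)
    have "card C \<le> card (g ` X)"
      unfolding C_def using finite_subset[OF sub fin] by (rule card_image_le)
    also have "\<dots> \<le> card (PiE (UNIV::'p set) (\<lambda>_. {..<\<nu>}))" by (rule card_mono[OF fin sub])
    also have "\<dots> = \<nu> ^ CARD('p)" by (simp add: card_PiE)
    finally show "card C \<le> \<nu> ^ CARD('p)" .
    show "\<exists>c\<in>C. norm (x - c) \<le> D / real \<nu> * sqrt (real CARD('p))" if x: "x \<in> X" for x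
    proof
      define c where "c = inv_into X g (g x)"
      show "c \<in> C" unfolding C_def c_def using x by auto
      have c: "c \<in> X" "g c = g x" unfolding c_def using x
        by (auto intro: inv_into_into f_inv_into_f)
      have "x - c = T (Y x) - T (Y c)" using Y(3)[OF x] Y(3)[OF c(1)] by (metis add_diff_cancel_left)
      also have "\<dots> = T (Y x - Y c)"
        using T by (simp add: orthogonal_transformation_def linear_diff)
      finally have "norm (x - c) = norm (Y x - Y c)"
        using T by (simp add: orthogonal_transformation_norm)
      also have "\<dots> \<le> norm ((\<chi> i. D / real \<nu>) :: real^'p)"
      proof (rule norm_le_componentwise_cart)
        fix i
        have "h (Y x $ i) = h (Y c $ i)" using c(2) unfolding g_def by metis
        then have "\<bar>Y x $ i - Y c $ i\<bar> \<le> D / real \<nu>" using h(2) Y x c(1) by blast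
        then show "norm ((Y x - Y c) $ i) \<le> norm (((\<chi> i. D / real \<nu>) :: real^'p) $ i)"
          using D by simp
      qed
      also have "\<dots> = sqrt ((D / real \<nu>)\<^sup>2 * real CARD('p))"
        by (simp add: norm_eq_sqrt_inner inner_vec_def power2_eq_square)
      also have "\<dots> = D / real \<nu> * sqrt (real CARD('p))"
        unfolding real_sqrt_mult real_sqrt_abs using D by simp
      finally show "norm (x - c) \<le> D / real \<nu> * sqrt (real CARD('p))" .
    qed
  qed
qed

text \<open>This is \<open>ln x \<le> x / e\<close> at \<open>x = n powr (1 - 2 * lam)\<close>. It
  is the source of the factor \<open>(1 - 2 * lam) * exp 1\<close> in
  \<open>N_const\<close>.\<close>

lemma ln_div_self_le:
  fixes n :: nat and lam :: real
  assumes n: "0 < n" and lam: "lam < 1 / 2"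
  shows "ln (real n) / real n \<le> 1 / ((1 - 2 * lam) * exp 1) * (real n powr (- lam))\<^sup>2"
proof -
  define q where "q = 1 - 2 * lam"
  have q: "0 < q" using lam by (simp add: q_def)
  have "q * ln (real n) = ln (real n powr q / exp 1) + 1"
    using n by (simp add: ln_div ln_powr)
  also have "\<dots> \<le> real n powr q / exp 1"
    using n ln_le_minus_one[of "real n powr q / exp 1"] by simp
  finally have "ln (real n) \<le> real n powr q / (q * exp 1)"
    using q by (simp add: field_simps)
  then have "ln (real n) / real n \<le> real n powr q / (q * exp 1) / real n"
    by (intro divide_right_mono) auto
  also have "real n powr q / (q * exp 1) / real n = 1 / (q * exp 1) * (real n powr q / real n powr 1)"
    using n by simp
  also have "real n powr q / real n powr 1 = real n powr (- lam + - lam)"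
    unfolding powr_diff[symmetric] by (simp add: q_def)
  also have "\<dots> = (real n powr (- lam))\<^sup>2"
    by (simp only: powr_add power2_eq_square)
  finally show ?thesis by (simp add: q_def)
qed

text \<open>The grid must be fine enough for a Hoelder error of order \<open>1 / sqrt n\<close>, yet
  the logarithm of its size must stay of order \<open>ln n\<close>. Rounding \<open>y\<close> up at
  most squares it, and \<open>y\<^sup>2 = n powr (1 / \<gamma>)\<close>.\<close>

lemma grid_size:
  fixes n :: nat and \<gamma> :: real
  assumes n: "0 < n" and \<gamma>: "0 < \<gamma>" "\<gamma> \<le> 1"
  defines "y \<equiv> real n powr (1 / (2 * \<gamma>))"
  defines "\<nu> \<equiv> nat \<lceil>y\<rceil>"
  shows "0 < \<nu>" "sqrt (real n) \<le> real \<nu> powr \<gamma>" "ln (real \<nu>) \<le> ln (real n) / \<gamma>"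
proof -
  have y1: "1 \<le> y" unfolding y_def using n \<gamma> by (intro ge_one_powr_ge_zero) auto
  have \<nu>: "y \<le> real \<nu>" "real \<nu> \<le> y + 1" unfolding \<nu>_def using y1 by linarith+
  show \<nu>0: "0 < \<nu>" using \<nu> y1 by linarith
  have "sqrt (real n) = y powr \<gamma>"
    unfolding y_def using n \<gamma> by (simp add: powr_powr powr_half_sqrt)
  also have "\<dots> \<le> real \<nu> powr \<gamma>" using \<nu> y1 \<gamma> by (intro powr_mono2) auto
  finally show "sqrt (real n) \<le> real \<nu> powr \<gamma>" .
  have y2: "y\<^sup>2 = real n powr (1 / \<gamma>)"
    unfolding y_def using \<gamma> by (simp add: power2_eq_square flip: powr_add)
  have "real \<nu> \<le> y\<^sup>2"
  \<comment> \<open>For \<open>n = 1\<close> nothing is rounded. Otherwise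
    \<open>y\<^sup>2 \<ge> n \<ge> 2\<close> because \<open>1 / \<gamma> \<ge> 1\<close>, which
    settles \<open>y \<le> 2\<close>; for larger \<open>y\<close>,
    \<open>y + 1 \<le> 2 * y \<le> y\<^sup>2\<close>.\<close>
  proof (cases "n = 1")
    case True
    then show ?thesis by (simp add: \<nu>_def y_def)
  next
    case False
    then have n2: "2 \<le> real n" using n by linarith
    have "real n powr 1 \<le> real n powr (1 / \<gamma>)"
      using n2 \<gamma> by (intro powr_mono) auto
    then have y22: "2 \<le> y\<^sup>2" using n2 unfolding y2 by simp
    show ?thesis
    proof (cases "y \<le> 2")
      case True
      then have "\<lceil>y\<rceil> \<le> 2" by (simp add: ceiling_le_iff)
      then have "real \<nu> \<le> 2" unfolding \<nu>_def by linarith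
      then show ?thesis using y22 by simp
    next
      case False
      then have "2 * y \<le> y * y" by (intro mult_right_mono) auto
      moreover have "real \<nu> \<le> 2 * y" using False \<nu> by linarith
      ultimately show ?thesis by (simp add: power2_eq_square)
    qed
  qed
  then have "ln (real \<nu>) \<le> ln (y\<^sup>2)" using \<nu>0 by (subst ln_le_cancel_iff) (auto intro: less_le_trans)
  also have "\<dots> = ln (real n) / \<gamma>" unfolding y2 using n by (simp add: ln_powr)
  finally show "ln (real \<nu>) \<le> ln (real n) / \<gamma>" .
qed

text \<open>The first summand of \<open>N_const\<close> pays for the Hoelder error of the net, the
  other two for the maximum over its \<open>K\<close> points: \<open>ln 2\<close> comes from the two
  signs and \<open>ln K\<close> from the number of points. All rates are relaxed to
  \<open>n powr (- lam)\<close>.\<close>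

lemma N_const_bound:
  fixes n K \<nu> :: nat
  assumes n: "0 < n" and K: "0 < K" "K \<le> \<nu> ^ p" and \<nu>: "0 < \<nu>"
    and grid: "sqrt (real n) \<le> real \<nu> powr \<gamma>" "ln (real \<nu>) \<le> ln (real n) / \<gamma>"
    and D: "0 \<le> D" and L: "0 \<le> L" and B: "0 < B" and \<gamma>: "0 < \<gamma>"
    and lam: "lam < 1 / 2"
  shows "2 * (L * (D / real \<nu> * sqrt (real p)) powr \<gamma>)
      + B * sqrt (2 * ln (2 * real K)) / sqrt (real n) \<le> 2 * N_const L \<gamma> B D p lam * real n powr (- lam)"
proof -
  define v where "v = real n powr (- lam)"
  have v0: "0 \<le> v" by (simp add: v_def)
  have vn: "1 / sqrt (real n) \<le> v"
  proof -
    have "real n powr (- (1 / 2)) \<le> real n powr (- lam)"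
      using n lam by (intro powr_mono) auto
    then show ?thesis using n by (simp add: v_def powr_minus powr_half_sqrt field_simps)
  qed
  have "(D / real \<nu> * sqrt (real p)) powr \<gamma> = D powr \<gamma> * real p powr (\<gamma> / 2) * (1 / real \<nu> powr \<gamma>)"
    using D by (simp add: powr_mult powr_divide powr_half_sqrt[symmetric] powr_powr mult.commute)
  also have "\<dots> \<le> D powr \<gamma> * real p powr (\<gamma> / 2) * v"
  proof (intro mult_left_mono)
    have "1 / real \<nu> powr \<gamma> \<le> 1 / sqrt (real n)" using grid(1) n \<nu> by (intro divide_left_mono) auto
    then show "1 / real \<nu> powr \<gamma> \<le> v" using vn by simp
  qed auto
  finally have first: "L * (D / real \<nu> * sqrt (real p)) powr \<gamma> \<le> L * (D powr \<gamma> * real p powr (\<gamma> / 2) * v)"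
    using L by (rule mult_left_mono)
  define q where "q = \<gamma> * (1 - 2 * lam) * exp 1"
  have q: "0 < q" unfolding q_def using \<gamma> lam by auto
  have ln_n: "0 \<le> ln (real n)" using n by simp
  have "ln (2 * real K) = ln 2 + ln (real K)" using K by (simp add: ln_mult)
  also have "ln (real K) \<le> ln (real (\<nu> ^ p))"
    using K by (subst ln_le_cancel_iff) (use K \<nu> in \<open>auto simp del: of_nat_power\<close>)
  also have "\<dots> = real p * ln (real \<nu>)" using \<nu> by (simp add: ln_realpow)
  also have "\<dots> \<le> real p * (ln (real n) / \<gamma>)" by (intro mult_left_mono grid) auto
  finally have lnK: "ln (2 * real K) \<le> ln 2 + real p * (ln (real n) / \<gamma>)" by simp
  have "sqrt (2 * ln (2 * real K)) / sqrt (real n) = sqrt (2 * ln (2 * real K) / real n)"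
    by (simp add: real_sqrt_divide)
  \<comment> \<open>The factor 4 leaves the root as the 2 in front of \<open>N_const\<close>. The
    \<open>ln n\<close> term needs only half of it, the \<open>ln 2\<close> term only a
    quarter.\<close>
  also have "\<dots> \<le> sqrt (4 * (2 * ln 2 * (1 / sqrt (real n))\<^sup>2 + real p * (ln (real n) / real n / \<gamma>)))"
  proof (rule real_sqrt_le_mono)
    have "2 * ln (2 * real K) / real n \<le> 2 * (ln 2 + real p * (ln (real n) / \<gamma>)) / real n"
      using lnK by (intro divide_right_mono) auto
    also have "\<dots> = 2 * ln 2 / real n + 2 * (real p * (ln (real n) / real n / \<gamma>))"
      by (simp add: add_divide_distrib distrib_left mult_ac)
    also have "\<dots> \<le> 8 * ln 2 / real n + 4 * (real p * (ln (real n) / real n / \<gamma>))"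
      using ln_n \<gamma> by (intro add_mono divide_right_mono mult_right_mono) auto
    also have "\<dots> = 4 * (2 * ln 2 * (1 / sqrt (real n))\<^sup>2 + real p * (ln (real n) / real n / \<gamma>))"
      by (simp add: power_divide)
    finally show "2 * ln (2 * real K) / real n \<le> \<dots>" .
  qed
  also have "\<dots> \<le> sqrt (4 * (2 * ln 2 * v\<^sup>2 + real p * (v\<^sup>2 / q)))"
  proof (intro real_sqrt_le_mono mult_left_mono add_mono power_mono vn)
    have "ln (real n) / real n / \<gamma> \<le> 1 / ((1 - 2 * lam) * exp 1) * v\<^sup>2 / \<gamma>"
      using ln_div_self_le[OF n lam] \<gamma> unfolding v_def by (intro divide_right_mono) auto
    also have "\<dots> = v\<^sup>2 / q" using \<gamma> lam by (simp add: q_def field_simps)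
    finally show "ln (real n) / real n / \<gamma> \<le> v\<^sup>2 / q" .
  qed auto
  also have "\<dots> = 2 * sqrt (2 * ln 2 * v\<^sup>2 + real p * (v\<^sup>2 / q))"
    by (subst real_sqrt_mult) simp
  also have "\<dots> \<le> 2 * (sqrt (2 * ln 2 * v\<^sup>2) + sqrt (real p * (v\<^sup>2 / q)))"
    using q by (intro mult_left_mono sqrt_add_le_add_sqrt) auto
  also have "\<dots> = 2 * (sqrt (2 * ln 2) + sqrt (real p) / sqrt q) * v"
    using v0 q by (simp add: real_sqrt_mult real_sqrt_divide field_simps)
  finally have "B * (sqrt (2 * ln (2 * real K)) / sqrt (real n))
      \<le> B * (2 * (sqrt (2 * ln 2) + sqrt (real p) / sqrt q) * v)"
    using B by (intro mult_left_mono) auto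
  with first show ?thesis
    by (simp add: N_const_def q_def v_def[symmetric] algebra_simps)
qed

section \<open>Uniform deviation under a Hoelder condition\<close>

text \<open>\<open>\<Xi>\<close> need not be measurable, so independence and laws are transferred to the trace
  sigma algebra on which \<open>F x\<close> is measurable.\<close>

lemma (in prob_space) indep_vars_restrict_space:
  assumes ind: "indep_vars (\<lambda>_. N) X I"
    and \<Xi>: "\<And>k \<omega>. k \<in> I \<Longrightarrow> \<omega> \<in> space M \<Longrightarrow> X k \<omega> \<in> \<Xi>"
  shows "indep_vars (\<lambda>_. restrict_space N \<Xi>) X I"
proof -
  have "{X k -` A \<inter> space M |A. A \<in> sets (restrict_space N \<Xi>)} = {X k -` A \<inter> space M |A. A \<in> sets N}"
    if "k \<in> I" for k
  proof -
    have "X k -` (\<Xi> \<inter> A) \<inter> space M = X k -` A \<inter> space M" for A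
      using \<Xi>[OF that] by auto
    then show ?thesis
      unfolding Setcompr_eq_image sets_restrict_space image_image Collect_mem_eq by simp
  qed
  then show ?thesis
    using ind \<Xi> unfolding indep_vars_def2
    by (auto intro!: measurable_restrict_space2 cong: indep_sets_cong)
qed

lemma distr_restrict_space_eq:
  assumes X: "X \<in> measurable M N" "\<And>\<omega>. \<omega> \<in> space M \<Longrightarrow> X \<omega> \<in> \<Xi>"
    and Y: "Y \<in> measurable M N" "\<And>\<omega>. \<omega> \<in> space M \<Longrightarrow> Y \<omega> \<in> \<Xi>"
    and eq: "distr M N X = distr M N Y"
  shows "distr M (restrict_space N \<Xi>) X = distr M (restrict_space N \<Xi>) Y"
proof (rule measure_eqI)
  have meas: "X \<in> measurable M (restrict_space N \<Xi>)" "Y \<in> measurable M (restrict_space N \<Xi>)"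
    using X Y by (auto intro!: measurable_restrict_space2)
  fix A assume "A \<in> sets (distr M (restrict_space N \<Xi>) X)"
  then have A: "A \<in> sets (restrict_space N \<Xi>)" by simp
  then obtain B where B: "B \<in> sets N" "A = \<Xi> \<inter> B" by (auto simp: sets_restrict_space)
  have "X -` A \<inter> space M = X -` B \<inter> space M" "Y -` A \<inter> space M = Y -` B \<inter> space M"
    using X(2) Y(2) by (auto simp: B)
  then show "emeasure (distr M (restrict_space N \<Xi>) X) A = emeasure (distr M (restrict_space N \<Xi>) Y) A"
    using A B meas X(1) Y(1) arg_cong[OF eq, of "\<lambda>Q. emeasure Q B"] by (simp add: emeasure_distr)
qed simp

text \<open>\<open>W\<close> is a maximum over a finite net, so neither the measurability of the supremum over \<open>X\<close>
  nor symmetrization is needed; the Hoelder condition passes from the net to \<open>X\<close>.\<close>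

lemma (in prob_space) uniform_deviation:
  fixes X :: "(real^'p) set" and F :: "real^'p \<Rightarrow> 's \<Rightarrow> real"
    and \<zeta> :: "'i \<Rightarrow> 'a \<Rightarrow> 's"
  assumes X: "X \<noteq> {}" "is_cube D Q" "X \<subseteq> Q"
    and F: "\<And>x. x \<in> X \<Longrightarrow> F x \<in> borel_measurable (restrict_space S \<Xi>)"
    and hoelder: "\<And>x y s. x \<in> X \<Longrightarrow> y \<in> X \<Longrightarrow> s \<in> \<Xi> \<Longrightarrow> \<bar>F x s - F y s\<bar> \<le> L * norm (x - y) powr \<gamma>"
    and bd: "\<And>x s. x \<in> X \<Longrightarrow> s \<in> \<Xi> \<Longrightarrow> \<bar>F x s\<bar> \<le> B"
    and const: "0 \<le> L" "0 < B" "0 < \<gamma>" "\<gamma> \<le> 1" "lam < 1 / 2"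
    and \<xi>: "\<xi> \<in> measurable M S" "\<And>\<omega>. \<omega> \<in> space M \<Longrightarrow> \<xi> \<omega> \<in> \<Xi>"
    and ind: "indep_vars (\<lambda>_. S) \<zeta> J"
    and law: "\<And>k. k \<in> J \<Longrightarrow> distr M S (\<zeta> k) = distr M S \<xi>"
    and \<zeta>: "\<And>k \<omega>. k \<in> J \<Longrightarrow> \<omega> \<in> space M \<Longrightarrow> \<zeta> k \<omega> \<in> \<Xi>"
    and J: "card J = n" "0 < n"
  obtains W where "integrable M W"
    and "expectation W \<le> 2 * N_const L \<gamma> B D CARD('p) lam * real n powr (- lam)"
    and "\<And>u. 0 \<le> u \<Longrightarrow> prob {\<omega> \<in> space M. 2 * N_const L \<gamma> B D CARD('p) lam * real n powr (- lam) + u \<le> W \<omega>}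
      \<le> exp (- (real n * u\<^sup>2 / (2 * B\<^sup>2)))"
    and "\<And>x \<omega>. x \<in> X \<Longrightarrow> \<omega> \<in> space M \<Longrightarrow>
      \<bar>(1 / real n) * (\<Sum>k\<in>J. F x (\<zeta> k \<omega>)) - true_obj M \<xi> F x\<bar> \<le> W \<omega>"
proof -
  have J': "finite J" "J \<noteq> {}" using J by (auto simp: card_gt_0_iff intro: card_ge_0_finite)
  have D: "0 \<le> D" using X by (simp add: is_cube_def)
  define \<nu> where "\<nu> = nat \<lceil>real n powr (1 / (2 * \<gamma>))\<rceil>"
  note \<nu> = grid_size[OF J(2) const(3,4), folded \<nu>_def]
  define r where "r = D / real \<nu> * sqrt (real CARD('p))"
  obtain C where C: "finite C" "C \<subseteq> X" "card C \<le> \<nu> ^ CARD('p)"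
    and net: "\<And>x. x \<in> X \<Longrightarrow> \<exists>c\<in>C. norm (x - c) \<le> r"
    unfolding r_def by (rule cube_net[OF X(2,3) \<nu>(1)]) blast
  have neC: "C \<noteq> {}" using net X(1) by auto
  define b where "b = L * r powr \<gamma>"
  define E where "E = 2 * N_const L \<gamma> B D CARD('p) lam * real n powr (- lam)"
  define a where "a = B * sqrt (2 * ln (2 * real (card C))) / sqrt (real n)"
  have ba: "2 * b + a \<le> E"
    unfolding b_def r_def a_def E_def
    using neC C const D J \<nu> by (intro N_const_bound) (auto simp: card_gt_0_iff)
  have \<xi>R: "\<xi> \<in> measurable M (restrict_space S \<Xi>)"
    using \<xi> by (auto intro!: measurable_restrict_space2)
  have \<zeta>S: "\<zeta> k \<in> measurable M S" if "k \<in> J" for k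
    using ind that unfolding indep_vars_def by auto
  have indR: "indep_vars (\<lambda>_. restrict_space S \<Xi>) \<zeta> J"
    using ind \<zeta> by (rule indep_vars_restrict_space)
  have \<zeta>R: "\<zeta> k \<in> measurable M (restrict_space S \<Xi>)" if "k \<in> J" for k
    using indR that unfolding indep_vars_def by auto
  have mean: "expectation (\<lambda>\<omega>. F c (\<zeta> k \<omega>)) = true_obj M \<xi> F c" if "c \<in> X" "k \<in> J" for c k
  proof -
    have "distr M (restrict_space S \<Xi>) (\<zeta> k) = distr M (restrict_space S \<Xi>) \<xi>"
      using that \<zeta> \<xi> \<zeta>S law by (intro distr_restrict_space_eq) auto
    then have "(LINT s|distr M (restrict_space S \<Xi>) (\<zeta> k). F c s) = (LINT s|distr M (restrict_space S \<Xi>) \<xi>. F c s)"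
      by simp
    then show ?thesis
      unfolding true_obj_def integral_distr[OF \<zeta>R[OF that(2)] F[OF that(1)]]
        integral_distr[OF \<xi>R F[OF that(1)]] .
  qed
  have int: "integrable M (\<lambda>\<omega>. F x (\<xi> \<omega>))" if "x \<in> X" for x
    using that \<xi> bd measurable_compose[OF \<xi>R F[OF that]]
    by (intro integrable_const_bound[where B = B]) auto
  define V where "V \<omega> = (MAX c\<in>C. \<bar>(1 / real n) * (\<Sum>k\<in>J. F c (\<zeta> k \<omega>)) - true_obj M \<xi> F c\<bar>)" for \<omega>
  have indF: "indep_vars (\<lambda>_. borel) (\<lambda>k \<omega>. F c (\<zeta> k \<omega>)) J" if "c \<in> C" for c
    using C that by (intro indep_vars_compose2[OF indR] F) auto
  have bdF: "\<bar>F c (\<zeta> k \<omega>)\<bar> \<le> B" if "c \<in> C" "k \<in> J" "\<omega> \<in> space M" for c k \<omega>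
    using C that \<zeta> by (intro bd) auto
  have meanF: "expectation (\<lambda>\<omega>. F c (\<zeta> k \<omega>)) = true_obj M \<xi> F c" if "c \<in> C" "k \<in> J" for c k
    using C that by (intro mean) auto
  note dev = C(1) neC J' indF bdF meanF const(2)
  have V: "integrable M V" "expectation V \<le> a"
    "\<And>u. 0 \<le> u \<Longrightarrow> prob {\<omega> \<in> space M. a + u \<le> V \<omega>} \<le> exp (- (real n * u\<^sup>2 / (2 * B\<^sup>2)))"
    using integrable_max_deviation[OF dev] expectation_max_deviation[OF dev]
      tail_max_deviation[OF dev]
    unfolding V_def a_def J(1) by simp_all
  \<comment> \<open>Replacing \<open>x\<close> by its net point changes the empirical average and
    the expectation by at most \<open>b\<close> each, hence the offset \<open>2 * b\<close>.\<close>
  show thesis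
  proof (rule that[of "\<lambda>\<omega>. 2 * b + V \<omega>"], unfold E_def[symmetric])
    show "integrable M (\<lambda>\<omega>. 2 * b + V \<omega>)" using V by simp
    show "expectation (\<lambda>\<omega>. 2 * b + V \<omega>) \<le> E" using V ba by (simp add: prob_space)
    show "prob {\<omega> \<in> space M. E + u \<le> 2 * b + V \<omega>} \<le> exp (- (real n * u\<^sup>2 / (2 * B\<^sup>2)))" if "0 \<le> u" for u
    proof -
      have [measurable]: "V \<in> borel_measurable M" using V(1) by auto
      have "prob {\<omega> \<in> space M. E + u \<le> 2 * b + V \<omega>} \<le> prob {\<omega> \<in> space M. a + u \<le> V \<omega>}"
        using ba by (intro finite_measure_mono) auto
      then show ?thesis using V(3)[OF that] by linarith
    qed
    fix x \<omega> assume x: "x \<in> X" and \<omega>: "\<omega> \<in> space M"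
    obtain c where c: "c \<in> C" "norm (x - c) \<le> r" using net[OF x] by auto
    have cX: "c \<in> X" using c C by auto
    have near: "\<bar>F x s - F c s\<bar> \<le> b" if "s \<in> \<Xi>" for s
    proof -
      have "L * norm (x - c) powr \<gamma> \<le> b" unfolding b_def
        using const c by (intro mult_left_mono powr_mono2) auto
      then show ?thesis using hoelder[OF x cX that] by linarith
    qed
    have "\<bar>(\<Sum>k\<in>J. F x (\<zeta> k \<omega>)) - (\<Sum>k\<in>J. F c (\<zeta> k \<omega>))\<bar> \<le> (\<Sum>k\<in>J. b)"
      unfolding sum_subtractf[symmetric] using near \<zeta> \<omega>
      by (intro order_trans[OF sum_abs] sum_mono) auto
    then have "(1 / real n) * \<bar>(\<Sum>k\<in>J. F x (\<zeta> k \<omega>)) - (\<Sum>k\<in>J. F c (\<zeta> k \<omega>))\<bar> \<le> (1 / real n) * (real n * b)"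
      using J by (intro mult_left_mono) auto
    then have "\<bar>(1 / real n) * ((\<Sum>k\<in>J. F x (\<zeta> k \<omega>)) - (\<Sum>k\<in>J. F c (\<zeta> k \<omega>)))\<bar> \<le> b"
      using J by (simp add: abs_mult)
    then have emp: "\<bar>(1 / real n) * (\<Sum>k\<in>J. F x (\<zeta> k \<omega>)) - (1 / real n) * (\<Sum>k\<in>J. F c (\<zeta> k \<omega>))\<bar> \<le> b"
      by (simp add: right_diff_distrib)
    have "\<bar>true_obj M \<xi> F x - true_obj M \<xi> F c\<bar> = \<bar>expectation (\<lambda>\<omega>. F x (\<xi> \<omega>) - F c (\<xi> \<omega>))\<bar>"
      unfolding true_obj_def using int x cX by simp
    also have "\<dots> \<le> expectation (\<lambda>\<omega>. \<bar>F x (\<xi> \<omega>) - F c (\<xi> \<omega>)\<bar>)" by (rule integral_abs_bound)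
    also have "\<dots> \<le> expectation (\<lambda>\<omega>. b)"
      using near \<xi> int x cX by (intro integral_mono) auto
    finally have true: "\<bar>true_obj M \<xi> F x - true_obj M \<xi> F c\<bar> \<le> b" by (simp add: prob_space)
    have "\<bar>(1 / real n) * (\<Sum>k\<in>J. F c (\<zeta> k \<omega>)) - true_obj M \<xi> F c\<bar> \<le> V \<omega>"
      unfolding V_def using C c by (intro Max_ge) auto
    then show "\<bar>(1 / real n) * (\<Sum>k\<in>J. F x (\<zeta> k \<omega>)) - true_obj M \<xi> F x\<bar> \<le> 2 * b + V \<omega>"
      using emp true by linarith
  qed
qed

section \<open>Convexity of sums and of the expected cost\<close>

lemma convex_on_sum_fun:
  assumes "finite J" "convex X" "\<And>k. k \<in> J \<Longrightarrow> convex_on X (p k)"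
  shows "convex_on X (\<lambda>x. \<Sum>k\<in>J. p k x)"
  using assms(1,3)
proof (induction J)
  case empty
  then show ?case using assms(2) by (simp add: convex_on_const)
qed (auto intro!: convex_on_add)

lemma convex_on_true_obj:
  assumes "convex X" and int: "\<And>x. x \<in> X \<Longrightarrow> integrable M (\<lambda>\<omega>. F x (\<xi> \<omega>))"
    and cvx: "\<And>\<omega>. \<omega> \<in> space M \<Longrightarrow> convex_on X (\<lambda>x. F x (\<xi> \<omega>))"
  shows "convex_on X (true_obj M \<xi> F)"
proof (rule convex_onI)
  fix t :: real and x y assume t: "0 < t" "t < 1" and x: "x \<in> X" and y: "y \<in> X"
  have "true_obj M \<xi> F ((1 - t) *\<^sub>R x + t *\<^sub>R y) \<le> (LINT \<omega>|M. (1 - t) * F x (\<xi> \<omega>) + t * F y (\<xi> \<omega>))"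
    unfolding true_obj_def
    using t x y int convexD[OF assms(1) x y, of "1 - t" t] convex_onD[OF cvx, of _ t x y]
    by (intro integral_mono) auto
  also have "\<dots> = (1 - t) * true_obj M \<xi> F x + t * true_obj M \<xi> F y"
    unfolding true_obj_def using int x y by simp
  finally show "true_obj M \<xi> F ((1 - t) *\<^sub>R x + t *\<^sub>R y) \<le> (1 - t) * true_obj M \<xi> F x + t * true_obj M \<xi> F y" .
qed (fact assms)

section \<open>Distance between approximate solution sets\<close>

lemma opt_value_le:
  assumes "bdd_below (h ` X)" "y \<in> X"
  shows "opt_value X h \<le> h y"
  unfolding opt_value_def using assms by (rule cINF_lower)

lemma le_opt_value:
  assumes "X \<noteq> {}" "\<And>y. y \<in> X \<Longrightarrow> c \<le> h y"
  shows "c \<le> opt_value X h"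
  unfolding opt_value_def using assms by (rule cINF_greatest)

lemma near_optimal_exists:
  assumes "X \<noteq> {}" "bdd_below (h ` X)" "0 < \<delta>"
  obtains y where "y \<in> X" "h y \<le> opt_value X h + \<delta>"
proof -
  have "(INF x\<in>X. h x) < opt_value X h + \<delta>" using assms by (simp add: opt_value_def)
  then show thesis using assms that by (auto simp: cINF_less_iff dest: less_imp_le)
qed

text \<open>Moving from \<open>x\<close> towards a point \<open>y\<close> with value at most
  \<open>opt_value X f + \<eta>\<close> by the fraction \<open>\<eta> / \<epsilon>\<close> lowers
  the convex bound to exactly \<open>opt_value X f + \<epsilon>\<close>. If
  \<open>\<eta> \<ge> \<epsilon>\<close>, any \<open>\<epsilon>\<close>-optimal point is close
  enough. The case \<open>\<eta> = 0\<close> is separate since the infimum need not be attained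
  here.\<close>

lemma eps_opt_set_near:
  fixes X :: "'x::real_normed_vector set"
  assumes X: "convex X" "bounded X" and f: "convex_on X f" and bdd: "bdd_below (f ` X)"
    and "0 < \<epsilon>" "0 \<le> \<eta>" and x: "x \<in> X" and fx: "f x \<le> opt_value X f + \<epsilon> + \<eta>"
  obtains b where "b \<in> eps_opt_set X f \<epsilon>" "norm (x - b) \<le> diameter X * \<eta> / \<epsilon>"
proof -
  have ne: "X \<noteq> {}" using x by auto
  have diam: "norm (x - y) \<le> diameter X" if "y \<in> X" for y
    using diameter_bounded_bound[OF X(2) x that] by (simp add: dist_norm)
  have diam0: "0 \<le> diameter X" using diam[OF x] by simp
  consider "\<eta> = 0" | "0 < \<eta>" "\<eta> < \<epsilon>" | "\<epsilon> \<le> \<eta>" using \<open>0 \<le> \<eta>\<close> by linarith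
  then show thesis
  proof cases
    case 1
    show thesis by (rule that[of x]) (use 1 x fx in \<open>auto simp: eps_opt_set_def\<close>)
  next
    case 2
    obtain y where y: "y \<in> X" "f y \<le> opt_value X f + \<eta>"
      using near_optimal_exists[OF ne bdd 2(1)] .
    define t where "t = \<eta> / \<epsilon>"
    have t: "0 \<le> t" "t \<le> 1" unfolding t_def using 2 by auto
    define b where "b = (1 - t) *\<^sub>R x + t *\<^sub>R y"
    have "b \<in> X" unfolding b_def using t by (intro convexD X x y) auto
    moreover have "f b \<le> (1 - t) * f x + t * f y"
      unfolding b_def using t by (intro convex_onD[OF f] x y) auto
    moreover have "\<dots> \<le> (1 - t) * (opt_value X f + \<epsilon> + \<eta>) + t * (opt_value X f + \<eta>)"
      using t fx y by (intro add_mono mult_left_mono) auto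
    moreover have "\<dots> = opt_value X f + \<epsilon>"
      unfolding t_def using \<open>0 < \<epsilon>\<close> by (simp add: field_simps)
    ultimately have "b \<in> eps_opt_set X f \<epsilon>" by (simp add: eps_opt_set_def)
    moreover have "x - b = t *\<^sub>R (x - y)" unfolding b_def by (simp add: algebra_simps)
    then have "norm (x - b) \<le> t * diameter X"
      using t diam[OF y(1)] by (simp add: mult_left_mono)
    ultimately show thesis by (intro that[of b]) (auto simp: t_def mult.commute)
  next
    case 3
    obtain y where y: "y \<in> X" "f y \<le> opt_value X f + \<epsilon>"
      using near_optimal_exists[OF ne bdd \<open>0 < \<epsilon>\<close>] .
    have "diameter X * 1 \<le> diameter X * (\<eta> / \<epsilon>)"
      using 3 \<open>0 < \<epsilon>\<close> diam0 by (intro mult_left_mono) auto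
    then show thesis
      using y diam[OF y(1)] by (intro that[of y]) (auto simp: eps_opt_set_def)
  qed
qed

lemma pessimistic_dist_le:
  assumes "A \<noteq> {}" and near: "\<And>a. a \<in> A \<Longrightarrow> \<exists>b\<in>B. norm (a - b) \<le> r"
  shows "pessimistic_dist A B \<le> r"
  unfolding pessimistic_dist_def
proof (intro cSUP_least)
  fix a assume "a \<in> A"
  then obtain b where b: "b \<in> B" "norm (a - b) \<le> r" using near by blast
  have "bdd_below ((\<lambda>b. norm (a - b)) ` B)" by (intro bdd_belowI2[of _ 0]) simp
  then show "(INF b\<in>B. norm (a - b)) \<le> r" using b by (intro cINF_lower2)
qed fact

text \<open>If \<open>s\<close> exceeds the diameter \<open>w\<close> the claim is trivial; otherwise use
  \<open>sqrt (1 + u) \<le> 1 + u / 2\<close>.\<close>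

lemma le_add_of_square_le:
  fixes d s w u :: real
  assumes "d \<le> w" "d\<^sup>2 \<le> s\<^sup>2 * (1 + u)" "0 \<le> s" "0 \<le> u" "0 \<le> w"
  shows "d \<le> s + w * (2 * u)"
proof (cases "w \<le> s")
  case True
  moreover have "0 \<le> w * (2 * u)" using assms by simp
  ultimately show ?thesis using assms by linarith
next
  case False
  have "d\<^sup>2 \<le> s\<^sup>2 * (1 + u)" by fact
  also have "\<dots> \<le> s\<^sup>2 * (1 + u / 2)\<^sup>2"
    by (intro mult_left_mono) (auto simp: power2_eq_square algebra_simps)
  also have "\<dots> = (s * (1 + u / 2))\<^sup>2" by (simp add: power_mult_distrib)
  finally have "d \<le> s * (1 + u / 2)"
    by (rule power2_le_imp_le) (use assms in auto)
  also have "\<dots> = s + s * (u / 2)" by (simp add: algebra_simps)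
  also have "s * (u / 2) \<le> w * (2 * u)" using False assms by (intro mult_mono) auto
  finally show ?thesis by simp
qed

text \<open>A deterministic estimate for one sample: \<open>g i\<close> are the sample averages,
  \<open>h i\<close> the models. Each model is squeezed between the constant
  \<open>g i (y i) - \<epsilon>'\<close> and \<open>g i\<close>. The distance is split at
  \<open>ybar\<close>: convexity bounds its distance to the true solution set, the quadratic term
  its distance to the compromise solutions.\<close>

lemma compromise_dist_le:
  fixes X :: "'x::real_normed_vector set" and f :: "'x \<Rightarrow> real"
    and g h :: "nat \<Rightarrow> 'x \<Rightarrow> real" and y :: "nat \<Rightarrow> 'x"
  assumes X: "convex X" "bounded X" "X \<noteq> {}" and f: "convex_on X f" and bdd: "bdd_below (f ` X)"
    and g: "\<And>i. i \<in> {1..m} \<Longrightarrow> convex_on X (g i)"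
    and dev: "\<And>i x. i \<in> {1..m} \<Longrightarrow> x \<in> X \<Longrightarrow> \<bar>g i x - f x\<bar> \<le> d i"
    and y: "\<And>i. i \<in> {1..m} \<Longrightarrow> y i \<in> X"
    and hg: "\<And>i x. i \<in> {1..m} \<Longrightarrow> x \<in> X \<Longrightarrow> h i x \<le> g i x"
    and gh: "\<And>i x. i \<in> {1..m} \<Longrightarrow> x \<in> X \<Longrightarrow> g i (y i) - \<epsilon>' \<le> h i x"
    and m: "0 < m" and \<epsilon>: "0 < \<epsilon>" "\<epsilon> \<le> \<epsilon>'" and \<rho>: "0 < \<rho>"
  defines "ybar \<equiv> (1 / real m) *\<^sub>R (\<Sum>j=1..m. y j)"
  defines "G \<equiv> \<lambda>x. (1 / real m) * (\<Sum>i=1..m. h i x) + \<rho> / 2 * (norm (x - ybar))\<^sup>2"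
  shows "pessimistic_dist (eps_opt_set X G \<epsilon>) (eps_opt_set X f \<epsilon>)
    \<le> diameter X / \<epsilon> * (2 * (\<epsilon>' - \<epsilon>) + (4 * real m - 2) / real m * ((1 / real m) * (\<Sum>i=1..m. d i)))
      + 2 * sqrt (\<epsilon> / \<rho>)"
proof -
  define w where "w = 1 / real m"
  have w: "0 < w" "real m * w = 1" "w * real m = 1" using m by (auto simp: w_def)
  define S where "S = (\<Sum>i=1..m. d i)"
  have d0: "0 \<le> d i" if "i \<in> {1..m}" for i
    using dev[OF that] X(3) by (metis abs_ge_zero all_not_in_conv order_trans)
  have S0: "0 \<le> S" unfolding S_def using d0 by (intro sum_nonneg) auto
  have ybar: "ybar = (\<Sum>j=1..m. w *\<^sub>R y j)" by (simp add: ybar_def w_def scaleR_right.sum)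
  have ybarX: "ybar \<in> X" unfolding ybar using w y
    by (intro convex_sum X) (auto simp: m)
  have jensen: "p ybar \<le> (\<Sum>j=1..m. w * p (y j))" if "convex_on X p" for p
    unfolding ybar using w y m that
    by (intro convex_on_sum[where C = X]) auto
  have Glow: "w * (\<Sum>i=1..m. g i (y i) - \<epsilon>') \<le> w * (\<Sum>i=1..m. h i x)" if "x \<in> X" for x
    using w that gh by (intro mult_left_mono sum_mono) auto
  have bddG: "bdd_below (G ` X)"
  proof (rule bdd_belowI2)
    fix x assume "x \<in> X"
    then show "w * (\<Sum>i=1..m. g i (y i) - \<epsilon>') \<le> G x"
      unfolding G_def w_def[symmetric] using Glow[of x] \<rho> by (intro add_increasing2) auto
  qed
  have fy: "f (y j) \<le> opt_value X f + \<epsilon>' + 2 * d j" if j: "j \<in> {1..m}" for j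
  proof -
    have "f (y j) - \<epsilon>' - 2 * d j \<le> opt_value X f"
    proof (rule le_opt_value[OF X(3)])
      fix x assume x: "x \<in> X"
      show "f (y j) - \<epsilon>' - 2 * d j \<le> f x"
        using dev[OF j x] dev[OF j y[OF j]] gh[OF j x] hg[OF j x] by linarith
    qed
    then show ?thesis by simp
  qed
  have "f ybar \<le> (\<Sum>j=1..m. w * f (y j))" by (rule jensen[OF f])
  also have "\<dots> \<le> (\<Sum>j=1..m. w * (opt_value X f + \<epsilon>' + 2 * d j))"
    using w fy by (intro sum_mono mult_left_mono) auto
  also have "\<dots> = opt_value X f + \<epsilon>' + 2 * (w * S)"
    unfolding sum_distrib_left[symmetric] sum.distrib S_def[symmetric] using m
    by (simp add: w_def field_simps)
  finally have fybar: "f ybar \<le> opt_value X f + \<epsilon> + (\<epsilon>' - \<epsilon> + 2 * (w * S))" by simp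
  obtain b where b: "b \<in> eps_opt_set X f \<epsilon>"
    "norm (ybar - b) \<le> diameter X * (\<epsilon>' - \<epsilon> + 2 * (w * S)) / \<epsilon>"
    by (rule eps_opt_set_near[OF X(1,2) f bdd \<epsilon>(1) _ ybarX fybar]) (use \<epsilon> w S0 in auto)
  \<comment> \<open>Passing from \<open>g i\<close> to \<open>g j\<close> through \<open>f\<close>
    costs \<open>d i + d j\<close>, but nothing when \<open>i = j\<close>. This saving on the
    diagonal turns \<open>m\<close> into \<open>m - 1\<close> in \<open>\<eta>\<close>.\<close>
  have cross: "g i (y j) \<le> g j (y j) + (d i + d j - (if i = j then 2 * d i else 0))"
    if "i \<in> {1..m}" "j \<in> {1..m}" for i j
    using dev[OF that(1) y[OF that(2)]] dev[OF that(2) y[OF that(2)]] by auto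
  define \<eta> where "\<eta> = \<epsilon>' - \<epsilon> + 2 * (real m - 1) * w * (w * S)"
  have \<eta>0: "0 \<le> \<eta>" unfolding \<eta>_def using \<epsilon> m w S0 by (intro add_nonneg_nonneg mult_nonneg_nonneg) auto
  \<comment> \<open>Jensen's inequality at \<open>ybar\<close> leads to the values of every
    \<open>g i\<close> at every \<open>y j\<close>; \<open>cross\<close> brings them back to the
    values \<open>g j (y j)\<close> that occur in \<open>Glow\<close>.\<close>
  have "w * (\<Sum>i=1..m. h i ybar) \<le> w * (\<Sum>i=1..m. \<Sum>j=1..m. w * g i (y j))"
    using w hg[OF _ ybarX] jensen[OF g] by (intro mult_left_mono sum_mono) (auto intro: order_trans)
  also have "\<dots> \<le> w * (\<Sum>i=1..m. \<Sum>j=1..m. w * (g j (y j) + (d i + d j - (if i = j then 2 * d i else 0))))"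
    using w cross by (intro mult_left_mono sum_mono) auto
  also have "\<dots> = w * (w * (real m * (\<Sum>j=1..m. g j (y j)) + (real m * S + real m * S - 2 * S)))"
  proof -
    have "(\<Sum>i=1..m. \<Sum>j=1..m. if i = j then 2 * d i else 0) = (\<Sum>i=1..m. 2 * d i)"
      by (intro sum.cong) auto
    then show ?thesis
      by (simp add: sum_distrib_left[symmetric] sum.distrib sum_subtractf S_def)
  qed
  also have "\<dots> = w * (\<Sum>j=1..m. g j (y j)) + 2 * (real m - 1) * w * (w * S)"
    using m by (simp add: w_def field_simps)
  also have "\<dots> = w * (\<Sum>i=1..m. g i (y i) - \<epsilon>') + \<epsilon> + \<eta>"
    using m by (simp add: sum_subtractf \<eta>_def w_def right_diff_distrib)
  finally have Gybar: "G ybar \<le> w * (\<Sum>i=1..m. g i (y i) - \<epsilon>') + \<epsilon> + \<eta>"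
    by (simp add: G_def w_def)
  show ?thesis
  proof (rule pessimistic_dist_le)
    show "eps_opt_set X G \<epsilon> \<noteq> {}"
      using near_optimal_exists[OF X(3) bddG \<epsilon>(1)] by (auto simp: eps_opt_set_def)
    fix x assume "x \<in> eps_opt_set X G \<epsilon>"
    then have x: "x \<in> X" and Gx: "G x \<le> opt_value X G + \<epsilon>" by (auto simp: eps_opt_set_def)
    have "G x \<le> G ybar + \<epsilon>" using Gx opt_value_le[OF bddG ybarX] by linarith
    then have "\<rho> / 2 * (norm (x - ybar))\<^sup>2 \<le> 2 * \<epsilon> + \<eta>"
      using Gybar Glow[OF x] unfolding G_def w_def by simp
    then have "(norm (x - ybar))\<^sup>2 \<le> 2 * (2 * \<epsilon> + \<eta>) / \<rho>"
      using \<rho> by (simp add: field_simps)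
    \<comment> \<open>Factoring out the part free of deviations prepares a bound linear in
      \<open>\<eta>\<close>, with \<open>2 * sqrt (\<epsilon> / \<rho>)\<close> as constant
      term.\<close>
    also have "\<dots> = (2 * sqrt (\<epsilon> / \<rho>))\<^sup>2 * (1 + \<eta> / (2 * \<epsilon>))"
      using \<rho> \<epsilon> by (simp add: power_mult_distrib field_simps)
    finally have "(norm (x - ybar))\<^sup>2 \<le> (2 * sqrt (\<epsilon> / \<rho>))\<^sup>2 * (1 + \<eta> / (2 * \<epsilon>))" .
    moreover have "norm (x - ybar) \<le> diameter X"
      using diameter_bounded_bound[OF X(2) x ybarX] by (simp add: dist_norm)
    moreover have "0 \<le> diameter X" by (rule diameter_ge_0[OF X(2)])
    ultimately have "norm (x - ybar) \<le> 2 * sqrt (\<epsilon> / \<rho>) + diameter X * (2 * (\<eta> / (2 * \<epsilon>)))"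
      using \<eta>0 \<epsilon> \<rho> by (intro le_add_of_square_le) auto
    then have "norm (x - b) \<le> 2 * sqrt (\<epsilon> / \<rho>) + diameter X * \<eta> / \<epsilon>
        + diameter X * (\<epsilon>' - \<epsilon> + 2 * (w * S)) / \<epsilon>"
      using b(2) norm_triangle_ineq[of "x - ybar" "ybar - b"] by simp
    also have "\<dots> = diameter X / \<epsilon> * (\<eta> + (\<epsilon>' - \<epsilon> + 2 * (w * S))) + 2 * sqrt (\<epsilon> / \<rho>)"
      by (simp add: algebra_simps add_divide_distrib diff_divide_distrib)
    also have "\<eta> + (\<epsilon>' - \<epsilon> + 2 * (w * S)) = 2 * (\<epsilon>' - \<epsilon>) + (4 * real m - 2) / real m * ((1 / real m) * S)"
      using m by (simp add: \<eta>_def w_def field_simps)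
    finally show "\<exists>b\<in>eps_opt_set X f \<epsilon>. norm (x - b) \<le>
        diameter X / \<epsilon> * (2 * (\<epsilon>' - \<epsilon>) + (4 * real m - 2) / real m * ((1 / real m) * (\<Sum>i=1..m. d i)))
        + 2 * sqrt (\<epsilon> / \<rho>)"
      using b(1) unfolding S_def by blast
  qed
qed

section \<open>Expectation and tail of the pessimistic distance\<close>

theorem theorem4p3:
  fixes M :: "'a measure"
    and \<Xi> :: "(real^'d) set" and X :: "(real^'p) set"
    and F :: "real^'p \<Rightarrow> real^'d \<Rightarrow> real"
    and \<xi> :: "'a \<Rightarrow> real^'d" and \<xi>s :: "nat \<Rightarrow> 'a \<Rightarrow> real^'d"
    and fhat :: "(nat \<Rightarrow> real^'d) \<Rightarrow> real^'p \<Rightarrow> real"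
    and xhat :: "(nat \<Rightarrow> real^'d) \<Rightarrow> real^'p"
    and \<upsilon> :: "nat \<Rightarrow> nat \<Rightarrow> (nat \<Rightarrow> real^'d) \<Rightarrow> real^'p"
    and D L\<^sub>F \<gamma> M\<^sub>F lam \<epsilon> \<epsilon>\<^sub>1 \<epsilon>\<^sub>2 \<rho> :: real
    and m n :: nat
  defines "z \<equiv> \<lambda>\<omega>. (\<lambda>k\<in>{1..m * n}. \<xi>s k \<omega>)"
  defines "\<Delta> \<equiv> \<lambda>\<omega>. pessimistic_dist
            (eps_opt_set X (compromise_obj F m n \<rho> \<epsilon>\<^sub>2 fhat xhat \<upsilon> (z \<omega>)) \<epsilon>)
            (eps_opt_set X (true_obj M \<xi> F) \<epsilon>)"
  defines "D\<^sub>X \<equiv> diameter X"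
    and "N\<^sub>F \<equiv> N_const L\<^sub>F \<gamma> M\<^sub>F D CARD('p) lam"
    and "\<tau>\<^sub>1 \<equiv> \<epsilon>\<^sub>1 - \<epsilon>"
    and "\<tau>\<^sub>2 \<equiv> \<epsilon>\<^sub>1 + (real m - 1) / real m * \<epsilon>\<^sub>2 - \<epsilon>"
  defines "C \<equiv> \<epsilon> powr (3 / 2) / D\<^sub>X + (4 * real m - 2) * N\<^sub>F / real m"
  assumes "prob_space M"
    \<comment> \<open>the feasible set\<close>
    and "X \<noteq> {}" and "compact X" and "convex X"
    and "\<exists>Q. is_cube D Q \<and> X \<subseteq> Q"
    \<comment> \<open>the cost function\<close>
    and "caratheodory_on X \<Xi> F"
    and "0 < \<gamma>" and "\<gamma> \<le> 1"
    and "\<forall>x\<in>X. \<forall>y\<in>X. \<forall>\<zeta>\<in>\<Xi>. \<bar>F x \<zeta> - F y \<zeta>\<bar> \<le> L\<^sub>F * norm (x - y) powr \<gamma>"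
    and "0 < M\<^sub>F"
    and "(SUP (x, \<zeta>)\<in>X \<times> \<Xi>. ereal \<bar>F x \<zeta>\<bar>) < ereal M\<^sub>F"
    and "\<forall>\<zeta>\<in>\<Xi>. convex_on X (\<lambda>x. F x \<zeta>)"
    \<comment> \<open>the random vector and its i.i.d. copies\<close>
    and "\<xi> \<in> borel_measurable M" and "\<forall>\<omega>\<in>space M. \<xi> \<omega> \<in> \<Xi>"
    and "prob_space.indep_vars M (\<lambda>_. borel) \<xi>s {1..m * n}"
    and "\<forall>k\<in>{1..m * n}. distr M borel (\<xi>s k) = distr M borel \<xi>"
    and "\<forall>k\<in>{1..m * n}. \<forall>\<omega>\<in>space M. \<xi>s k \<omega> \<in> \<Xi>"
    \<comment> \<open>the parameters\<close>
    and "0 < lam" and "lam < 1 / 2"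
    and "0 < \<epsilon>" and "0 < \<epsilon>\<^sub>1" and "0 \<le> \<epsilon>\<^sub>2" and "0 < \<rho>"
    and "0 < m" and "0 < n"
    and "\<epsilon> \<le> \<epsilon>\<^sub>1"
    \<comment> \<open>the output of the algorithm and the subgradients, for every sample\<close>
    and "\<forall>\<omega>\<in>space M. \<forall>i\<in>{1..m}.
           outer_approximation X (sample_avg F n (replication n i (z \<omega>)))
             (fhat (replication n i (z \<omega>)))"
    and "\<forall>\<omega>\<in>space M. \<forall>i\<in>{1..m}.
           termination_condition X (sample_avg F n (replication n i (z \<omega>)))
             (fhat (replication n i (z \<omega>))) \<epsilon>\<^sub>1 (xhat (replication n i (z \<omega>)))"
    and "\<forall>\<omega>\<in>space M. \<forall>i\<in>{1..m}. \<forall>j\<in>{1..m}.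
           eps_subgradient X (sample_avg F n (replication n i (z \<omega>))) \<epsilon>\<^sub>2
             (xhat (replication n j (z \<omega>))) (\<upsilon> i j (z \<omega>))"
    \<comment> \<open>measurability of the selections and of the pessimistic distance\<close>
    and "\<forall>i\<in>{1..m}. (\<lambda>\<omega>. xhat (replication n i (z \<omega>))) \<in> borel_measurable M"
    and "\<forall>i\<in>{1..m}. \<forall>j\<in>{1..m}. (\<lambda>\<omega>. \<upsilon> i j (z \<omega>)) \<in> borel_measurable M"
    and "\<Delta> \<in> borel_measurable M"
  shows "(LINT \<omega>|M. \<Delta> \<omega>)
           \<le> D\<^sub>X * N\<^sub>F / \<epsilon> * ((8 * real m - 4) / (real m * real n powr lam))
             + (\<tau>\<^sub>1 + \<tau>\<^sub>2) * D\<^sub>X / \<epsilon> + 2 * sqrt (\<epsilon> / \<rho>)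
       \<and> (\<epsilon>\<^sub>1 = \<epsilon> \<and> \<epsilon>\<^sub>2 = 0 \<and> \<rho> = real n \<and> 0 < D\<^sub>X \<longrightarrow>
           (\<forall>t\<ge>0. \<P>(\<omega> in M. \<epsilon> * real n powr lam / (2 * D\<^sub>X) * \<Delta> \<omega> \<ge> C + t)
              \<le> real m * exp (- ((real m)\<^sup>2 * t\<^sup>2 / (2 * M\<^sub>F\<^sup>2 * (2 * real m - 1)\<^sup>2)))))"
proof -
  interpret prob_space M by fact
  note X = \<open>X \<noteq> {}\<close> \<open>compact X\<close> \<open>convex X\<close>
    and mn = \<open>0 < m\<close> \<open>0 < n\<close>
    and eps = \<open>0 < \<epsilon>\<close> \<open>\<epsilon> \<le> \<epsilon>\<^sub>1\<close> \<open>0 \<le> \<epsilon>\<^sub>2\<close> \<open>0 < \<rho>\<close>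
  have bdX: "bounded X" using X by (simp add: compact_imp_bounded)
  have DX0: "0 \<le> D\<^sub>X" unfolding D\<^sub>X_def by (rule diameter_ge_0[OF bdX])
  obtain Q where Q: "is_cube D Q" "X \<subseteq> Q" using \<open>\<exists>Q. is_cube D Q \<and> X \<subseteq> Q\<close> by auto
  have Fm: "F x \<in> borel_measurable (restrict_space borel \<Xi>)" if "x \<in> X" for x
    using \<open>caratheodory_on X \<Xi> F\<close> that by (simp add: caratheodory_on_def)
  have bd: "\<bar>F x s\<bar> \<le> M\<^sub>F" if "x \<in> X" "s \<in> \<Xi>" for x s
  proof -
    have "ereal \<bar>F x s\<bar> \<le> (SUP (x, \<zeta>)\<in>X \<times> \<Xi>. ereal \<bar>F x \<zeta>\<bar>)"
      using that by (intro SUP_upper2[of "(x, s)"]) auto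
    also have "\<dots> < ereal M\<^sub>F" by fact
    finally show ?thesis by simp
  qed
  have \<xi>: "\<xi> \<in> borel_measurable M" "\<And>\<omega>. \<omega> \<in> space M \<Longrightarrow> \<xi> \<omega> \<in> \<Xi>"
    using \<open>\<forall>\<omega>\<in>space M. \<xi> \<omega> \<in> \<Xi>\<close> by (auto intro: \<open>\<xi> \<in> borel_measurable M\<close>)
  have hoelder: "\<bar>F x s - F x' s\<bar> \<le> L\<^sub>F * norm (x - x') powr \<gamma>" if "x \<in> X" "x' \<in> X" "s \<in> \<Xi>" for x x' s
    using \<open>\<forall>x\<in>X. \<forall>y\<in>X. \<forall>\<zeta>\<in>\<Xi>. \<bar>F x \<zeta> - F y \<zeta>\<bar> \<le> L\<^sub>F * norm (x - y) powr \<gamma>\<close> that by blast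
  have \<xi>s_range: "\<xi>s k \<omega> \<in> \<Xi>" if "k \<in> {1..m * n}" "\<omega> \<in> space M" for k \<omega>
    using \<open>\<forall>k\<in>{1..m * n}. \<forall>\<omega>\<in>space M. \<xi>s k \<omega> \<in> \<Xi>\<close> that by blast
  have \<xi>s_law: "distr M borel (\<xi>s k) = distr M borel \<xi>" if "k \<in> {1..m * n}" for k
    using \<open>\<forall>k\<in>{1..m * n}. distr M borel (\<xi>s k) = distr M borel \<xi>\<close> that by blast
  have intF: "integrable M (\<lambda>\<omega>. F x (\<xi> \<omega>))" if "x \<in> X" for x
  proof (rule integrable_const_bound)
    show "AE \<omega> in M. norm (F x (\<xi> \<omega>)) \<le> M\<^sub>F" using bd[OF that] \<xi> by auto
    have "\<xi> \<in> measurable M (restrict_space borel \<Xi>)" using \<xi> by (auto intro!: measurable_restrict_space2)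
    then show "(\<lambda>\<omega>. F x (\<xi> \<omega>)) \<in> borel_measurable M" by (rule measurable_compose) (rule Fm[OF that])
  qed
  define f where "f = true_obj M \<xi> F"
  have f_bd: "\<bar>f x\<bar> \<le> M\<^sub>F" if "x \<in> X" for x
  proof -
    have "\<bar>f x\<bar> \<le> expectation (\<lambda>\<omega>. \<bar>F x (\<xi> \<omega>)\<bar>)"
      unfolding f_def true_obj_def by (rule integral_abs_bound)
    also have "\<dots> \<le> expectation (\<lambda>\<omega>. M\<^sub>F)"
      using bd[OF that] \<xi> intF[OF that] by (intro integral_mono) auto
    finally show ?thesis by (simp add: prob_space)
  qed
  have f_cvx: "convex_on X f"
    unfolding f_def using \<open>\<forall>\<zeta>\<in>\<Xi>. convex_on X (\<lambda>x. F x \<zeta>)\<close> \<xi>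
    by (intro convex_on_true_obj X intF) auto
  have f_bdd: "bdd_below (f ` X)"
    using f_bd by (intro bdd_belowI2[of _ "- M\<^sub>F"]) (auto simp: abs_le_iff minus_le_iff)
  \<comment> \<open>The block of sample indices belonging to replication \<open>i\<close>.\<close>
  define J where "J i = (\<lambda>j. (i - 1) * n + j) ` {1..n}" for i
  have cardJ: "card (J i) = n" for i
    unfolding J_def by (subst card_image) (auto simp: inj_on_def)
  have Jsub: "J i \<subseteq> {1..m * n}" if "i \<in> {1..m}" for i
  proof
    fix k assume "k \<in> J i"
    then obtain j where j: "j \<in> {1..n}" "k = (i - 1) * n + j" unfolding J_def by blast
    then have "k \<le> (i - 1) * n + n" by simp
    also have "\<dots> = i * n" using that by (cases i) auto
    also have "\<dots> \<le> m * n" using that by auto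
    finally show "k \<in> {1..m * n}" using j by auto
  qed
  define g where "g \<omega> i = sample_avg F n (replication n i (z \<omega>))" for \<omega> i
  have g_eq: "g \<omega> i x = (1 / real n) * (\<Sum>k\<in>J i. F x (\<xi>s k \<omega>))" if "i \<in> {1..m}" for \<omega> i x
  proof -
    have "(\<Sum>k\<in>J i. F x (\<xi>s k \<omega>)) = (\<Sum>j=1..n. F x (\<xi>s ((i - 1) * n + j) \<omega>))"
      unfolding J_def by (subst sum.reindex) (auto simp: inj_on_def)
    also have "\<dots> = (\<Sum>j=1..n. F x (replication n i (z \<omega>) j))"
    \<comment> \<open>The indices stay in \<open>{1..n}\<close> and \<open>{1..m * n}\<close>, so
      the restrictions in \<open>replication\<close> and \<open>z\<close> never return
      \<open>undefined\<close>.\<close>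
    proof (intro sum.cong refl)
      fix j assume j: "j \<in> {1..n}"
      then have "(i - 1) * n + j \<in> {1..m * n}" using Jsub[OF that] unfolding J_def by blast
      then show "F x (\<xi>s ((i - 1) * n + j) \<omega>) = F x (replication n i (z \<omega>) j)"
        using j by (simp add: replication_def z_def)
    qed
    finally show ?thesis by (simp add: g_def sample_avg_def)
  qed
  have g_cvx: "convex_on X (g \<omega> i)" if "\<omega> \<in> space M" "i \<in> {1..m}" for \<omega> i
  proof -
    have "\<xi>s k \<omega> \<in> \<Xi>" if "k \<in> J i" for k
      using \<xi>s_range Jsub \<open>i \<in> {1..m}\<close> \<open>\<omega> \<in> space M\<close> that by blast
    then have "convex_on X (\<lambda>x. (1 / real n) * (\<Sum>k\<in>J i. F x (\<xi>s k \<omega>)))"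
      using \<open>\<forall>\<zeta>\<in>\<Xi>. convex_on X (\<lambda>x. F x \<zeta>)\<close> X
      by (intro convex_on_cmul convex_on_sum_fun) (auto simp: J_def)
    moreover have "g \<omega> i = (\<lambda>x. (1 / real n) * (\<Sum>k\<in>J i. F x (\<xi>s k \<omega>)))"
      by (rule ext) (rule g_eq[OF that(2)])
    ultimately show ?thesis by simp
  qed
  define y where "y \<omega> i = xhat (replication n i (z \<omega>))" for \<omega> i
  define h where "h \<omega> i = augmented F m n \<epsilon>\<^sub>2 fhat xhat \<upsilon> (z \<omega>) i" for \<omega> i
  have terminates: "termination_condition X (g \<omega> i) (fhat (replication n i (z \<omega>))) \<epsilon>\<^sub>1 (y \<omega> i)"
    if "\<omega> \<in> space M" "i \<in> {1..m}" for \<omega> i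
    unfolding g_def y_def
    using \<open>\<forall>\<omega>\<in>space M. \<forall>i\<in>{1..m}. termination_condition X (sample_avg F n (replication n i (z \<omega>)))
             (fhat (replication n i (z \<omega>))) \<epsilon>\<^sub>1 (xhat (replication n i (z \<omega>)))\<close> that by blast
  have outer: "outer_approximation X (g \<omega> i) (fhat (replication n i (z \<omega>)))"
    if "\<omega> \<in> space M" "i \<in> {1..m}" for \<omega> i
    unfolding g_def
    using \<open>\<forall>\<omega>\<in>space M. \<forall>i\<in>{1..m}. outer_approximation X (sample_avg F n (replication n i (z \<omega>)))
             (fhat (replication n i (z \<omega>)))\<close> that by blast
  have subgr: "eps_subgradient X (g \<omega> i) \<epsilon>\<^sub>2 (y \<omega> j) (\<upsilon> i j (z \<omega>))"
    if "\<omega> \<in> space M" "i \<in> {1..m}" "j \<in> {1..m}" for \<omega> i j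
    unfolding g_def y_def
    using \<open>\<forall>\<omega>\<in>space M. \<forall>i\<in>{1..m}. \<forall>j\<in>{1..m}.
           eps_subgradient X (sample_avg F n (replication n i (z \<omega>))) \<epsilon>\<^sub>2
             (xhat (replication n j (z \<omega>))) (\<upsilon> i j (z \<omega>))\<close> that by blast
  have yX: "y \<omega> i \<in> X" if "\<omega> \<in> space M" "i \<in> {1..m}" for \<omega> i
    using terminates[OF that] by (simp add: termination_condition_def is_arg_min_def)
  \<comment> \<open>Every piece of the maximum is a minorant: \<open>fhat\<close> by outer
    approximation, each cut by the inequality defining its subgradient.\<close>
  have hg: "h \<omega> i x \<le> g \<omega> i x" if "\<omega> \<in> space M" "i \<in> {1..m}" "x \<in> X" for \<omega> i x
    unfolding h_def augmented_def
    using outer[OF that(1,2)] subgr[OF that(1,2)] that(3) mn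
    by (auto simp: outer_approximation_def eps_subgradient_def g_def y_def)
  \<comment> \<open>\<open>fhat\<close> is minimal at \<open>y \<omega> i\<close>, where it is
    within \<open>\<epsilon>\<^sub>1\<close> of \<open>g \<omega> i\<close>; the maximum can only
    raise it.\<close>
  have gh: "g \<omega> i (y \<omega> i) - \<epsilon>\<^sub>1 \<le> h \<omega> i x" if "\<omega> \<in> space M" "i \<in> {1..m}" "x \<in> X" for \<omega> i x
  proof -
    have "g \<omega> i (y \<omega> i) - \<epsilon>\<^sub>1 \<le> fhat (replication n i (z \<omega>)) x"
      using terminates[OF that(1,2)] that(3) by (force simp: termination_condition_def is_arg_min_linorder)
    then show ?thesis unfolding h_def augmented_def by simp
  qed
  define \<Phi> where "\<Phi> s = D\<^sub>X / \<epsilon> * (2 * (\<epsilon>\<^sub>1 - \<epsilon>) + (4 * real m - 2) / real m * s) + 2 * sqrt (\<epsilon> / \<rho>)" for s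
  have bound: "\<Delta> \<omega> \<le> \<Phi> ((1 / real m) * (\<Sum>i=1..m. d i))"
    if \<omega>: "\<omega> \<in> space M" and d: "\<And>i x. i \<in> {1..m} \<Longrightarrow> x \<in> X \<Longrightarrow> \<bar>g \<omega> i x - f x\<bar> \<le> d i" for \<omega> d
  proof -
    have "compromise_obj F m n \<rho> \<epsilon>\<^sub>2 fhat xhat \<upsilon> (z \<omega>) = (\<lambda>x. (1 / real m) * (\<Sum>i=1..m. h \<omega> i x)
        + \<rho> / 2 * (norm (x - (1 / real m) *\<^sub>R (\<Sum>j=1..m. y \<omega> j)))\<^sup>2)"
      by (simp add: fun_eq_iff compromise_obj_def h_def y_def)
    then show ?thesis
      unfolding \<Delta>_def \<Phi>_def D\<^sub>X_def f_def[symmetric]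
      using compromise_dist_le[OF X(3) bdX X(1) f_cvx f_bdd g_cvx[OF \<omega>] d yX[OF \<omega>] hg[OF \<omega>] gh[OF \<omega>]
          mn(1) eps(1,2,4)]
      by simp
  qed
  define v where "v = real n powr (- lam)"
  have nv: "real n powr lam * v = 1" unfolding v_def using mn by (simp flip: powr_add)
  have v0: "0 < v" unfolding v_def using mn by simp
  \<comment> \<open>The difference of the two sides is
    \<open>(m - 1) / m * \<epsilon>\<^sub>2\<close>, which is nonnegative.\<close>
  have \<tau>: "2 * (\<epsilon>\<^sub>1 - \<epsilon>) \<le> \<tau>\<^sub>1 + \<tau>\<^sub>2" unfolding \<tau>\<^sub>1_def \<tau>\<^sub>2_def using mn eps by simp
  have \<Phi>_le: "\<Phi> (2 * N\<^sub>F * v) \<le> D\<^sub>X * N\<^sub>F / \<epsilon> * ((8 * real m - 4) / (real m * real n powr lam))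
             + (\<tau>\<^sub>1 + \<tau>\<^sub>2) * D\<^sub>X / \<epsilon> + 2 * sqrt (\<epsilon> / \<rho>)"
  proof -
    have "\<Phi> (2 * N\<^sub>F * v) = D\<^sub>X / \<epsilon> * (2 * (\<epsilon>\<^sub>1 - \<epsilon>)) + D\<^sub>X * N\<^sub>F / \<epsilon> * ((8 * real m - 4) / real m * v)
        + 2 * sqrt (\<epsilon> / \<rho>)"
      unfolding \<Phi>_def by (simp add: algebra_simps diff_divide_distrib)
    also have "(8 * real m - 4) / real m * v = (8 * real m - 4) / (real m * real n powr lam)"
      by (simp add: v_def powr_minus field_simps)
    also have "D\<^sub>X / \<epsilon> * (2 * (\<epsilon>\<^sub>1 - \<epsilon>)) \<le> D\<^sub>X / \<epsilon> * (\<tau>\<^sub>1 + \<tau>\<^sub>2)"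
      using \<tau> DX0 eps by (intro mult_left_mono) auto
    finally show ?thesis by (simp add: mult_ac)
  qed
  show ?thesis
  proof (cases "D\<^sub>X = 0")
    \<comment> \<open>If \<open>X\<close> is a singleton, \<open>L\<^sub>F\<close> and \<open>N\<^sub>F\<close> may be negative.\<close>
    case True
    have "\<Delta> \<omega> \<le> 2 * sqrt (\<epsilon> / \<rho>)" if \<omega>: "\<omega> \<in> space M" for \<omega>
    proof -
      \<comment> \<open>Any finite deviation bound serves here, as \<open>\<Phi>\<close> is constant
        when \<open>D\<^sub>X = 0\<close>.\<close>
      have "\<bar>g \<omega> i x - f x\<bar> \<le> M\<^sub>F + M\<^sub>F" if i: "i \<in> {1..m}" and x: "x \<in> X" for i x
      proof -
        have "\<bar>\<Sum>k\<in>J i. F x (\<xi>s k \<omega>)\<bar> \<le> (\<Sum>k\<in>J i. M\<^sub>F)"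
          using bd[OF x] \<xi>s_range Jsub[OF i] \<omega> by (intro order_trans[OF sum_abs] sum_mono) blast
        then have "\<bar>g \<omega> i x\<bar> \<le> M\<^sub>F"
          unfolding g_eq[OF i] using mn cardJ by (simp add: abs_mult field_simps)
        then show ?thesis using f_bd[OF x] by linarith
      qed
      from bound[OF \<omega> this] show ?thesis using True by (simp add: \<Phi>_def)
    qed
    then have "(LINT \<omega>|M. \<Delta> \<omega>) \<le> expectation (\<lambda>\<omega>. 2 * sqrt (\<epsilon> / \<rho>))"
      using eps by (intro integral_mono') auto
    then show ?thesis using True by (simp add: prob_space)
  next
    case False
    then have DX: "0 < D\<^sub>X" using DX0 by simp
    have L: "0 \<le> L\<^sub>F"
    proof -
      obtain x where x: "x \<in> X" using X by auto
      have "X \<noteq> {x}" using DX by (auto simp: D\<^sub>X_def)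
      then obtain x' where x': "x' \<in> X" "x' \<noteq> x" using x by auto
      obtain \<omega> where "\<omega> \<in> space M" using not_empty by auto
      then have "\<bar>F x (\<xi> \<omega>) - F x' (\<xi> \<omega>)\<bar> \<le> L\<^sub>F * norm (x - x') powr \<gamma>"
        using hoelder x x' \<xi> by blast
      then have "0 \<le> L\<^sub>F * norm (x - x') powr \<gamma>" by linarith
      then show ?thesis using x' by (simp add: zero_le_mult_iff)
    qed
    define controls where "controls i W \<longleftrightarrow> integrable M W \<and> expectation W \<le> 2 * N\<^sub>F * v \<and>
        (\<forall>u\<ge>0. prob {\<omega> \<in> space M. 2 * N\<^sub>F * v + u \<le> W \<omega>} \<le> exp (- (real n * u\<^sup>2 / (2 * M\<^sub>F\<^sup>2)))) \<and>
        (\<forall>x\<in>X. \<forall>\<omega>\<in>space M. \<bar>g \<omega> i x - f x\<bar> \<le> W \<omega>)" for i W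
    have "\<forall>i\<in>{1..m}. \<exists>W. controls i W"
    proof
      fix i assume i: "i \<in> {1..m}"
      have ind: "indep_vars (\<lambda>_. borel) \<xi>s (J i)"
        using \<open>indep_vars (\<lambda>_. borel) \<xi>s {1..m * n}\<close> Jsub[OF i] by (rule indep_vars_subset)
      have law: "distr M borel (\<xi>s k) = distr M borel \<xi>" if "k \<in> J i" for k
        using \<xi>s_law Jsub[OF i] that by blast
      have range: "\<xi>s k \<omega> \<in> \<Xi>" if "k \<in> J i" "\<omega> \<in> space M" for k \<omega>
        using \<xi>s_range Jsub[OF i] that by blast
      show "\<exists>W. controls i W"
      proof (rule uniform_deviation[where F = F and J = "J i" and \<zeta> = \<xi>s and X = X and \<Xi> = \<Xi>
            and \<xi> = \<xi> and L = L\<^sub>F and \<gamma> = \<gamma> and B = M\<^sub>F and lam = lam,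
            OF X(1) Q Fm hoelder bd L \<open>0 < M\<^sub>F\<close> \<open>0 < \<gamma>\<close> \<open>\<gamma> \<le> 1\<close> \<open>lam < 1 / 2\<close> \<xi> ind law range cardJ mn(2)])
        fix W
        assume "integrable M W"
          and "expectation W \<le> 2 * N_const L\<^sub>F \<gamma> M\<^sub>F D CARD('p) lam * real n powr (- lam)"
          and "\<And>u. 0 \<le> u \<Longrightarrow> prob {\<omega> \<in> space M. 2 * N_const L\<^sub>F \<gamma> M\<^sub>F D CARD('p) lam * real n powr (- lam) + u \<le> W \<omega>}
            \<le> exp (- (real n * u\<^sup>2 / (2 * M\<^sub>F\<^sup>2)))"
          and "\<And>x \<omega>. x \<in> X \<Longrightarrow> \<omega> \<in> space M \<Longrightarrow>
            \<bar>(1 / real n) * (\<Sum>k\<in>J i. F x (\<xi>s k \<omega>)) - true_obj M \<xi> F x\<bar> \<le> W \<omega>"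
        then have "controls i W"
          by (simp add: controls_def N\<^sub>F_def v_def f_def g_eq[OF i])
        then show ?thesis by (rule exI[of _ W])
      qed
    qed
    from bchoice[OF this] obtain W where ctl: "\<forall>i\<in>{1..m}. controls i (W i)" ..
    have W: "\<And>i. i \<in> {1..m} \<Longrightarrow> integrable M (W i)"
      "\<And>i. i \<in> {1..m} \<Longrightarrow> expectation (W i) \<le> 2 * N\<^sub>F * v"
      "\<And>i u. i \<in> {1..m} \<Longrightarrow> 0 \<le> u \<Longrightarrow>
        prob {\<omega> \<in> space M. 2 * N\<^sub>F * v + u \<le> W i \<omega>} \<le> exp (- (real n * u\<^sup>2 / (2 * M\<^sub>F\<^sup>2)))"
      "\<And>i x \<omega>. i \<in> {1..m} \<Longrightarrow> x \<in> X \<Longrightarrow> \<omega> \<in> space M \<Longrightarrow> \<bar>g \<omega> i x - f x\<bar> \<le> W i \<omega>"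
      using ctl unfolding controls_def by auto
    define A where "A \<omega> = (1 / real m) * (\<Sum>i=1..m. W i \<omega>)" for \<omega>
    have \<Delta>_le: "\<Delta> \<omega> \<le> \<Phi> (A \<omega>)" if "\<omega> \<in> space M" for \<omega>
      unfolding A_def using that W(4) by (intro bound) auto
    have A0: "0 \<le> A \<omega>" if "\<omega> \<in> space M" for \<omega>
    proof -
      obtain x where "x \<in> X" using X by auto
      then have "0 \<le> W i \<omega>" if "i \<in> {1..m}" for i
        using W(4)[OF that _ \<open>\<omega> \<in> space M\<close>] by (meson abs_ge_zero order_trans)
      then show ?thesis unfolding A_def by (intro mult_nonneg_nonneg sum_nonneg) auto
    qed
    have \<Phi>_mono: "\<Phi> s \<le> \<Phi> s'" if "s \<le> s'" for s s'
      unfolding \<Phi>_def using that mn eps DX0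
      by (intro add_mono mult_left_mono order_refl divide_nonneg_nonneg) auto
    have intA: "integrable M A" unfolding A_def
      by (intro integrable_mult_right Bochner_Integration.integrable_sum W(1))
    have EA: "expectation A \<le> 2 * N\<^sub>F * v"
    proof -
      have "expectation A = (1 / real m) * (\<Sum>i=1..m. expectation (W i))"
        unfolding A_def integral_mult_right_zero
        by (subst Bochner_Integration.integral_sum) (use W(1) in auto)
      also have "\<dots> \<le> (1 / real m) * (\<Sum>i=1..m. 2 * N\<^sub>F * v)"
        by (intro mult_left_mono sum_mono W(2)) auto
      finally show ?thesis using mn by simp
    qed
    \<comment> \<open>The Bochner integral of a non-integrable function is 0, so an integrable
      nonnegative upper bound is enough. Being affine, \<open>\<Phi>\<close> then commutes with the
      expectation.\<close>
    have "(LINT \<omega>|M. \<Delta> \<omega>) \<le> expectation (\<lambda>\<omega>. \<Phi> (A \<omega>))"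
    proof (rule integral_mono')
      show "integrable M (\<lambda>\<omega>. \<Phi> (A \<omega>))" unfolding \<Phi>_def using intA by auto
      show "0 \<le> \<Phi> (A \<omega>)" if "\<omega> \<in> space M" for \<omega>
        unfolding \<Phi>_def using A0[OF that] DX0 eps mn by auto
    qed (rule \<Delta>_le)
    also have "\<dots> = \<Phi> (expectation A)"
      unfolding \<Phi>_def using intA by (simp add: prob_space)
    also have "\<dots> \<le> \<Phi> (2 * N\<^sub>F * v)" by (rule \<Phi>_mono[OF EA])
    also note \<Phi>_le
    finally have part1: "(LINT \<omega>|M. \<Delta> \<omega>)
           \<le> D\<^sub>X * N\<^sub>F / \<epsilon> * ((8 * real m - 4) / (real m * real n powr lam))
             + (\<tau>\<^sub>1 + \<tau>\<^sub>2) * D\<^sub>X / \<epsilon> + 2 * sqrt (\<epsilon> / \<rho>)" .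
    have part2: "\<P>(\<omega> in M. \<epsilon> * real n powr lam / (2 * D\<^sub>X) * \<Delta> \<omega> \<ge> C + t)
              \<le> real m * exp (- ((real m)\<^sup>2 * t\<^sup>2 / (2 * M\<^sub>F\<^sup>2 * (2 * real m - 1)\<^sup>2)))"
      if eq: "\<epsilon>\<^sub>1 = \<epsilon>" "\<rho> = real n" and t: "0 \<le> t" for t
    proof -
      \<comment> \<open>Chosen so that the increment \<open>u\<close> of the deviation raises
        \<open>\<kappa> * \<Phi>\<close> by exactly \<open>t\<close>.\<close>
      define u where "u = v * (real m * t / (2 * real m - 1))"
      have m1: "0 < 2 * real m - 1" using mn by linarith
      have u0: "0 \<le> u" unfolding u_def using v0 m1 t by auto
      define \<kappa> where "\<kappa> = \<epsilon> * real n powr lam / (2 * D\<^sub>X)"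
      have \<kappa>: "0 < \<kappa>" unfolding \<kappa>_def using eps DX mn by auto
      have nlam: "real n powr lam \<le> sqrt (real n)"
        unfolding powr_half_sqrt[OF of_nat_0_le_iff, symmetric]
        using mn \<open>lam < 1 / 2\<close> by (intro powr_mono) auto
      have \<Phi>_val: "\<kappa> * \<Phi> (2 * N\<^sub>F * v + u) \<le> C + t"
      proof -
        have "\<kappa> * \<Phi> (2 * N\<^sub>F * v + u)
            = \<kappa> * (D\<^sub>X / \<epsilon>) * ((4 * real m - 2) / real m * (2 * N\<^sub>F * v + u)) + \<kappa> * (2 * sqrt (\<epsilon> / real n))"
          unfolding \<Phi>_def eq by (simp add: distrib_left)
        also have "\<kappa> * (D\<^sub>X / \<epsilon>) = real n powr lam / 2"
          unfolding \<kappa>_def using eps DX by simp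
        also have "real n powr lam / 2 * ((4 * real m - 2) / real m * (2 * N\<^sub>F * v + u))
            = (real n powr lam * v) * ((4 * real m - 2) * N\<^sub>F / real m)
            + (real n powr lam * v) * ((4 * real m - 2) / (2 * real m) * (real m * t / (2 * real m - 1)))"
        proof -
          have "a / 2 * (b / c * (2 * N\<^sub>F * v + v * q)) = (a * v) * (b * N\<^sub>F / c) + (a * v) * (b / (2 * c) * q)"
            for a b c q :: real
            by (cases "c = 0") (simp_all add: field_simps)
          then show ?thesis unfolding u_def .
        qed
        also have "\<kappa> * (2 * sqrt (\<epsilon> / real n)) = \<epsilon> * (sqrt \<epsilon> * (real n powr lam / sqrt (real n))) / D\<^sub>X"
          unfolding \<kappa>_def real_sqrt_divide by (simp add: mult_ac)
        also have "(4 * real m - 2) / (2 * real m) * (real m * t / (2 * real m - 1)) = t"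
          using mn m1 by (simp add: field_simps)
        \<comment> \<open>With \<open>\<rho> = n\<close> the quadratic term decays like
          \<open>1 / sqrt n\<close>, which outweighs the scaling by \<open>n powr lam\<close>; the
          rest is the first summand of \<open>C\<close>.\<close>
        also have "\<epsilon> * (sqrt \<epsilon> * (real n powr lam / sqrt (real n))) / D\<^sub>X \<le> \<epsilon> * (sqrt \<epsilon> * 1) / D\<^sub>X"
          using nlam mn eps DX by (intro divide_right_mono mult_left_mono) auto
        also have "\<epsilon> * (sqrt \<epsilon> * 1) = \<epsilon> powr (1 + 1 / 2)"
          unfolding powr_add using eps by (simp add: powr_half_sqrt)
        finally show ?thesis unfolding nv C_def by simp
      qed
      \<comment> \<open>If every \<open>W i\<close> is below the threshold, so is their average, and
        the scaled distance is strictly below \<open>C + t\<close>. The union bound over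
        replications then yields the factor \<open>m\<close>.\<close>
      have sub: "{\<omega> \<in> space M. C + t \<le> \<kappa> * \<Delta> \<omega>} \<subseteq> (\<Union>i\<in>{1..m}. {\<omega> \<in> space M. 2 * N\<^sub>F * v + u \<le> W i \<omega>})"
      proof (rule subsetI, rule ccontr)
        fix \<omega>
        assume "\<omega> \<in> {\<omega> \<in> space M. C + t \<le> \<kappa> * \<Delta> \<omega>}"
        then have \<omega>: "\<omega> \<in> space M" "C + t \<le> \<kappa> * \<Delta> \<omega>" by auto
        assume outside: "\<omega> \<notin> (\<Union>i\<in>{1..m}. {\<omega> \<in> space M. 2 * N\<^sub>F * v + u \<le> W i \<omega>})"
        have small: "W i \<omega> < 2 * N\<^sub>F * v + u" if "i \<in> {1..m}" for i
        proof (rule ccontr)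
          assume "\<not> W i \<omega> < 2 * N\<^sub>F * v + u"
          then have "\<omega> \<in> {\<omega> \<in> space M. 2 * N\<^sub>F * v + u \<le> W i \<omega>}" using \<omega>(1) by simp
          then show False using outside that by blast
        qed
        have "A \<omega> < (1 / real m) * (\<Sum>i=1..m. 2 * N\<^sub>F * v + u)"
          unfolding A_def using mn small by (intro mult_strict_left_mono sum_strict_mono) auto
        then have "A \<omega> < 2 * N\<^sub>F * v + u" using mn by simp
        then have "\<Phi> (A \<omega>) < \<Phi> (2 * N\<^sub>F * v + u)"
          unfolding \<Phi>_def using DX eps mn
          by (intro add_strict_right_mono mult_strict_left_mono add_strict_left_mono) auto
        then have "\<kappa> * \<Delta> \<omega> < \<kappa> * \<Phi> (2 * N\<^sub>F * v + u)"
          using \<Delta>_le[OF \<omega>(1)] \<kappa> by (intro mult_strict_left_mono) auto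
        then show False using \<omega>(2) \<Phi>_val by linarith
      qed
      have Wm[measurable]: "W i \<in> borel_measurable M" if "i \<in> {1..m}" for i using W(1)[OF that] by auto
      have "prob {\<omega> \<in> space M. C + t \<le> \<kappa> * \<Delta> \<omega>}
          \<le> prob (\<Union>i\<in>{1..m}. {\<omega> \<in> space M. 2 * N\<^sub>F * v + u \<le> W i \<omega>})"
        using sub Wm by (intro finite_measure_mono sets.finite_UN) auto
      also have "\<dots> \<le> (\<Sum>i=1..m. prob {\<omega> \<in> space M. 2 * N\<^sub>F * v + u \<le> W i \<omega>})"
        using Wm by (intro finite_measure_subadditive_finite) auto
      also have "\<dots> \<le> (\<Sum>i=1..m. exp (- (real n * u\<^sup>2 / (2 * M\<^sub>F\<^sup>2))))"
        by (intro sum_mono W(3) u0)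
      also have "\<dots> = real m * exp (- (real n * u\<^sup>2 / (2 * M\<^sub>F\<^sup>2)))" by simp
      also have "\<dots> \<le> real m * exp (- ((real m)\<^sup>2 * t\<^sup>2 / (2 * M\<^sub>F\<^sup>2 * (2 * real m - 1)\<^sup>2)))"
      proof -
        define q where "q = real m * t / (2 * real m - 1)"
        \<comment> \<open>Since \<open>n * v\<^sup>2 \<ge> 1\<close>, replacing \<open>u\<close> by
          \<open>q\<close> and dropping \<open>n\<close> can only enlarge the exponential.\<close>
        have "1 / sqrt (real n) \<le> v"
          using nlam mn by (simp add: v_def powr_minus field_simps)
        then have "(1 / sqrt (real n))\<^sup>2 \<le> v\<^sup>2" by (intro power_mono) auto
        then have "1 \<le> real n * v\<^sup>2" using mn by (simp add: power_divide field_simps)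
        then have "1 * q\<^sup>2 \<le> real n * v\<^sup>2 * q\<^sup>2" by (intro mult_right_mono) auto
        then have "q\<^sup>2 / (2 * M\<^sub>F\<^sup>2) \<le> real n * u\<^sup>2 / (2 * M\<^sub>F\<^sup>2)"
          unfolding u_def q_def[symmetric] by (intro divide_right_mono) (auto simp: power_mult_distrib)
        moreover have "q\<^sup>2 / (2 * M\<^sub>F\<^sup>2) = (real m)\<^sup>2 * t\<^sup>2 / (2 * M\<^sub>F\<^sup>2 * (2 * real m - 1)\<^sup>2)"
          by (simp add: q_def power_divide power_mult_distrib mult_ac)
        ultimately show ?thesis
          by (intro mult_left_mono iffD2[OF exp_le_cancel_iff] iffD2[OF neg_le_iff_le] of_nat_0_le_iff) simp
      qed
      finally show ?thesis by (simp add: \<kappa>_def)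
    qed
    show ?thesis using part1 part2 by blast
  qed
qed

end
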